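(* Let $d\geq 2$ and let $\phi\colon (0,\infty)\to (0,\infty)$ be an increasing, concave function. Then $\phi$-displacement equivalence of separated nets in $\mathbb{R}^{d}$ is stronger than bilipschitz equivalence (that is, any two $\phi$-displacement equivalent separated nets in $\mathbb{R}^d$ are bilipschitz equivalent) if and only if $\phi$ is bounded.
   Context: A set $Z\subseteq\mathbb{R}^d$ is separated if $\inf\{\|z-z'\|_2: z,z'\in Z,\ z\ne z'\}>0$, and a net of $\mathbb{R}^d$ if $\sup_{x\in\mathbb{R}^d}\inf_{z\in Z}\|z-x\|_2<\infty$; a separated net is a set that is both. A function $\phi$ is increasing if $s\le t$ implies $\phi(s)\le\phi(t)$. For $f\colon A\subseteq\mathbb{R}^d\to\mathbb{R}^d$ and $R>0$, $\operatorname{disp}_R(f):=\sup\{\|f(x)-x\|_2: x\in A,\ \|x\|_2\le R\}$, with $\operatorname{disp}_R(f):=0$ if $A\cap\overline{B}(\mathbf{0},R)=\emptyset$. Separated nets $X,Y\subseteq\mathbb{R}^d$ are called $\phi$-displacement equivalent if there is a bijection $f\colon X\to Y$ with $\operatorname{disp}_R(f)\in O(\phi(R))$, i.e. $\limsup_{R\to\infty}\operatorname{disp}_R(f)/\phi(R)<\infty$. Separated nets $X,Y\subseteq\mathbb{R}^d$ are bilipschitz equivalent if there is a bijection $X\to Y$ that is Lipschitz with Lipschitz inverse (with respect to the Euclidean distance). *)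

theory Defs
  imports "HOL-Analysis.Analysis"
begin

text \<open>
  Infima, suprema and upper limits are taken in \<open>ereal\<close>, so that they exist without side
  conditions and \<open>INF\<close> over the empty set is \<open>\<infinity>\<close>; in particular the empty set is not a net.
\<close>

definition separated :: "(real ^ 'n) set \<Rightarrow> bool" where
  "separated Z \<longleftrightarrow> (INF (z, z') \<in> {(z, z'). z \<in> Z \<and> z' \<in> Z \<and> z \<noteq> z'}. ereal (norm (z - z'))) > 0"

definition net :: "(real ^ 'n) set \<Rightarrow> bool" where
  "net Z \<longleftrightarrow> (SUP x. INF z \<in> Z. ereal (norm (z - x))) < \<infinity>"

definition separated_net :: "(real ^ 'n) set \<Rightarrow> bool" where
  "separated_net Z \<longleftrightarrow> separated Z \<and> net Z"

text \<open>
  A function with domain \<open>A\<close> is a total function together with the set \<open>A\<close>. The case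
  distinction is needed because \<open>SUP\<close> over the empty set is \<open>-\<infinity>\<close> in \<open>ereal\<close>.
\<close>

definition disp :: "(real ^ 'n) set \<Rightarrow> (real ^ 'n \<Rightarrow> real ^ 'n) \<Rightarrow> real \<Rightarrow> ereal" where
  "disp A f R = (if A \<inter> cball 0 R = {} then 0
     else (SUP x \<in> {x \<in> A. norm x \<le> R}. ereal (norm (f x - x))))"

definition displacement_equivalent ::
  "(real \<Rightarrow> real) \<Rightarrow> (real ^ 'n) set \<Rightarrow> (real ^ 'n) set \<Rightarrow> bool" where
  "displacement_equivalent \<phi> X Y \<longleftrightarrow>
     (\<exists>f. bij_betw f X Y \<and> Limsup at_top (\<lambda>R. disp X f R / ereal (\<phi> R)) < \<infinity>)"

definition bilipschitz_equivalent :: "(real ^ 'n) set \<Rightarrow> (real ^ 'n) set \<Rightarrow> bool" where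
  "bilipschitz_equivalent X Y \<longleftrightarrow>
     (\<exists>f. bij_betw f X Y \<and> (\<exists>L. L-lipschitz_on X f) \<and> (\<exists>L. L-lipschitz_on Y (inv_into X f)))"

end

theory Submission
  imports Defs
begin

text \<open>
  If \<open>\<phi>\<close> is bounded, a bijection of displacement \<open>O(\<phi>)\<close> moves all points by at most a
  constant. Distances between distinct points of a separated set are bounded below, so such an
  additive error is also a multiplicative one, and the bijection is bilipschitz
  (\<open>bounded_displacement_bilipschitz\<close>).

  If \<open>\<phi>\<close> is unbounded, the lattice \<open>\<int>\<^sup>d\<close> is compared with a net \<open>X\<close> obtained from it by moving
  points inside the slabs \<open>R K \<le> x\<^sub>a < R K + len K\<close>, where \<open>a\<close> is one coordinate
  direction. No point of slab \<open>K\<close> moves by more than \<open>len K\<close>, and \<open>R K\<close> is chosen so large that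
  \<open>\<phi> (R K) \<ge> len K\<close>. Slab \<open>K\<close> is designed so that it excludes all bijections
  \<open>f: X \<rightarrow> \<int>\<^sup>d\<close> that are bilipschitz with constant \<open>L = K + 1\<close>.

  The design is a discrete form of the Burago--Kleiner construction of densities that are not
  Jacobians of bilipschitz maps. There are \<open>n\<close> scales. Scale \<open>i\<close> has strips of thickness
  \<open>side i\<close> in a second coordinate direction \<open>b\<close>, repeated periodically; across the direction \<open>a\<close> the
  strips are cut into blocks of length \<open>side i\<close> in which the density of \<open>X\<close> is alternately \<open>3/2\<close> and
  \<open>1/2\<close>. Where strips of several scales overlap, the finest scale decides; but the finer strips are so
  thin that they occupy only a tenth of each cube of side \<open>side i\<close> in a strip of scale \<open>i\<close>. It is for
  the direction \<open>b\<close> that the dimension has to be at least two.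

  Suppose that \<open>f\<close> stretches a segment of length \<open>side (i+1) = N * side i\<close> in the direction \<open>a\<close>
  by a factor \<open>A\<close>. Cut it into \<open>N\<close> steps of length \<open>side i\<close>, and consider with each step its
  translates to the points of a grid that is finer by the factor \<open>M\<close>. If some translate is
  stretched by \<open>(1 + k) * A\<close>, continue with it on the next scale. Otherwise all translates are
  stretched by less than that, while their sums are almost as long as the image of the
  segment. So the steps are mostly straight, and by the pigeonhole principle there are
  neighbouring cubes \<open>S\<close> (dense) and \<open>S + s e\<^sub>a\<close> (sparse), \<open>s = side i\<close>, such that
  \<open>f (q + s e\<^sub>a) - f q\<close> is almost the same vector for all grid points \<open>q\<close> of \<open>S\<close>. Round it to a
  lattice vector \<open>w\<close>. Since \<open>f\<close> maps onto the lattice, \<open>x \<mapsto> f\<inverse> (f x + w)\<close> is an injective map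
  of \<open>X\<close> into itself, and by the bilipschitz condition it moves the points of \<open>S\<close> almost by
  \<open>s e\<^sub>a\<close>: it embeds the points in \<open>S\<close> into a small neighbourhood of the sparse cube, where there
  are too few of them (\<open>transport\<close>, \<open>card_heavy\<close>, \<open>card_light\<close>). This surjectivity argument
  takes the place of the comparison of the areas enclosed by two nearby boundary curves in the
  continuous setting.

  Hence the stretching factor grows by \<open>1 + k\<close> from each scale to the next
  (\<open>stretch_step\<close>); it is at least \<open>1 / L\<close> at the beginning, and exceeds \<open>L\<close> after \<open>n\<close> scales,
  a contradiction (\<open>no_such_bijection\<close>).
\<close>

section \<open>Separated nets and bounded displacement\<close>

lemma separatedI:
  assumes "0 < r" "\<And>z z'. z \<in> Z \<Longrightarrow> z' \<in> Z \<Longrightarrow> z \<noteq> z' \<Longrightarrow> r \<le> norm (z - z')"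
  shows "separated Z"
proof -
  have "ereal r \<le> (INF (z, z') \<in> {(z, z'). z \<in> Z \<and> z' \<in> Z \<and> z \<noteq> z'}. ereal (norm (z - z')))"
    using assms(2) by (auto intro!: INF_greatest)
  moreover have "0 < ereal r" using assms(1) by simp
  ultimately show ?thesis unfolding separated_def by (rule less_le_trans[rotated])
qed

lemma separatedE:
  assumes "separated Z"
  obtains r where "0 < r" "\<And>z z'. z \<in> Z \<Longrightarrow> z' \<in> Z \<Longrightarrow> z \<noteq> z' \<Longrightarrow> r \<le> norm (z - z')"
proof -
  let ?I = "INF (z, z') \<in> {(z, z'). z \<in> Z \<and> z' \<in> Z \<and> z \<noteq> z'}. ereal (norm (z - z'))"
  have "0 < ?I" using assms by (simp add: separated_def)
  then obtain r where r: "0 < ereal r" "ereal r < ?I" using ereal_dense2 by blast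
  show ?thesis
  proof (rule that)
    show "0 < r" using r by simp
    fix z z' assume "z \<in> Z" "z' \<in> Z" "z \<noteq> z'"
    then have "?I \<le> ereal (norm (z - z'))" by (intro INF_lower2[of "(z, z')"]) auto
    then have "ereal r \<le> ereal (norm (z - z'))" by (rule order_trans[OF less_imp_le[OF r(2)]])
    then show "r \<le> norm (z - z')" by simp
  qed
qed

lemma netI:
  assumes "\<And>x. \<exists>z\<in>Z. norm (z - x) \<le> r"
  shows "net Z"
proof -
  have "(SUP x. INF z \<in> Z. ereal (norm (z - x))) \<le> ereal r"
  proof (rule SUP_least)
    fix x
    obtain z where "z \<in> Z" "norm (z - x) \<le> r" using assms by blast
    then show "(INF z \<in> Z. ereal (norm (z - x))) \<le> ereal r" by (intro INF_lower2[of z]) auto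
  qed
  then show ?thesis unfolding net_def by (rule le_less_trans) simp
qed

text \<open>
  An additive error of \<open>2 * B\<close> is at most \<open>2 * B / r\<close> times the distance of two distinct points.
\<close>

lemma bounded_displacement_lipschitz:
  fixes f :: "'a :: real_normed_vector \<Rightarrow> 'a"
  assumes r: "0 < r" "\<And>z z'. z \<in> X \<Longrightarrow> z' \<in> X \<Longrightarrow> z \<noteq> z' \<Longrightarrow> r \<le> norm (z - z')"
    and B: "\<And>x. x \<in> X \<Longrightarrow> norm (f x - x) \<le> B" "0 \<le> B"
  shows "(1 + 2 * B / r)-lipschitz_on X f"
proof (rule lipschitz_onI)
  fix x y assume xy: "x \<in> X" "y \<in> X"
  show "dist (f x) (f y) \<le> (1 + 2 * B / r) * dist x y"
  proof (cases "x = y")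
    case False
    have "norm (f x - f y) \<le> norm (x - y) + (B + B)"
      using norm_triangle_ineq[of "f x - x" "x - f y"] norm_triangle_ineq[of "x - y" "y - f y"]
        B(1)[OF xy(1)] B(1)[OF xy(2)] norm_minus_commute[of y "f y"] by simp
    moreover have "B + B \<le> 2 * B / r * norm (x - y)"
      using mult_left_mono[OF r(2)[OF xy False], of "2 * B / r"] B(2) r(1) by simp
    ultimately show ?thesis by (simp add: dist_norm algebra_simps)
  qed simp
qed (use B r in auto)

lemma bounded_displacement_bilipschitz:
  fixes X Y :: "(real ^ 'n) set"
  assumes X: "separated X" and Y: "separated Y" and bij: "bij_betw f X Y"
    and B: "\<And>x. x \<in> X \<Longrightarrow> norm (f x - x) \<le> B"
  shows "bilipschitz_equivalent X Y"
proof -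
  obtain r where r: "0 < r" "\<And>z z'. z \<in> X \<Longrightarrow> z' \<in> X \<Longrightarrow> z \<noteq> z' \<Longrightarrow> r \<le> norm (z - z')"
    using separatedE[OF X] by metis
  obtain q where q: "0 < q" "\<And>z z'. z \<in> Y \<Longrightarrow> z' \<in> Y \<Longrightarrow> z \<noteq> z' \<Longrightarrow> q \<le> norm (z - z')"
    using separatedE[OF Y] by metis
  have B': "norm (inv_into X f y - y) \<le> max B 0" if "y \<in> Y" for y
  proof -
    have "inv_into X f y \<in> X" "f (inv_into X f y) = y"
      using bij that by (auto simp: bij_betw_def inv_into_into f_inv_into_f)
    then show ?thesis using B[of "inv_into X f y"] by (simp add: norm_minus_commute)
  qed
  have "(1 + 2 * max B 0 / r)-lipschitz_on X f"
    by (rule bounded_displacement_lipschitz[OF r]) (use B in \<open>auto simp: le_max_iff_disj\<close>)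
  moreover have "(1 + 2 * max B 0 / q)-lipschitz_on Y (inv_into X f)"
    by (rule bounded_displacement_lipschitz[OF q]) (use B' in auto)
  ultimately show ?thesis using bij unfolding bilipschitz_equivalent_def by blast
qed

lemma bounded_displacement_function:
  fixes X Y :: "(real ^ 'n) set"
  assumes pos: "\<And>t. t > 0 \<Longrightarrow> \<phi> t > 0" and bd: "bounded (\<phi> ` {0<..})"
    and lim: "Limsup at_top (\<lambda>R. disp X f R / ereal (\<phi> R)) < \<infinity>"
  shows "\<exists>B. \<forall>x\<in>X. norm (f x - x) \<le> B"
proof -
  obtain C where "\<forall>y\<in>\<phi> ` {0<..}. norm y \<le> C" using bd unfolding bounded_iff by blast
  then have C: "\<phi> t \<le> C" if "t > 0" for t using that by force
  obtain c where c: "Limsup at_top (\<lambda>R. disp X f R / ereal (\<phi> R)) < ereal c"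
    using lim less_PInf_Ex_of_nat[of "Limsup at_top (\<lambda>R. disp X f R / ereal (\<phi> R))"] by auto
  then have ev: "eventually (\<lambda>R. disp X f R / ereal (\<phi> R) < ereal c) at_top"
    by (rule Limsup_lessD)
  have "norm (f x - x) \<le> \<bar>c\<bar> * C" if x: "x \<in> X" for x
  proof -
    have "eventually (\<lambda>R. norm x \<le> R \<and> 0 < R) at_top"
      using eventually_ge_at_top[of "norm x"] eventually_gt_at_top[of 0] by eventually_elim simp
    then obtain R where R: "disp X f R / ereal (\<phi> R) < ereal c" "norm x \<le> R" "0 < R"
      using eventually_happens'[OF trivial_limit_at_top_linorder eventually_conj[OF ev]] by blast
    have pR: "0 < \<phi> R" using pos R by simp
    have "ereal (norm (f x - x)) \<le> disp X f R"
      using x R(2) by (auto simp: disp_def intro!: SUP_upper)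
    then have "ereal (norm (f x - x)) / ereal (\<phi> R) \<le> disp X f R / ereal (\<phi> R)"
      using pR by (intro ereal_divide_right_mono) auto
    then have "ereal (norm (f x - x) / \<phi> R) \<le> disp X f R / ereal (\<phi> R)" using pR by simp
    then have "ereal (norm (f x - x) / \<phi> R) < ereal c" using R(1) by (rule le_less_trans)
    then have "norm (f x - x) / \<phi> R < c" by simp
    then have "norm (f x - x) < c * \<phi> R" using pR by (simp add: field_simps)
    also have "c * \<phi> R \<le> \<bar>c\<bar> * C" using C[OF R(3)] pR by (intro mult_mono) auto
    finally show ?thesis by simp
  qed
  then show ?thesis by blast
qed

section \<open>Criteria for the two equivalences\<close>

lemma displacement_equivalentI:
  fixes X Y :: "(real ^ 'n) set"
  assumes bij: "bij_betw f X Y" and pos: "\<And>t. t > 0 \<Longrightarrow> \<phi> t > 0"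
    and le: "\<And>x r. x \<in> X \<Longrightarrow> norm x \<le> r \<Longrightarrow> 0 < r \<Longrightarrow> norm (f x - x) \<le> \<phi> r"
  shows "displacement_equivalent \<phi> X Y"
proof -
  have "disp X f r / ereal (\<phi> r) \<le> 1" if r: "r > 0" for r
  proof -
    have "disp X f r \<le> ereal (\<phi> r)"
      using le[OF _ _ r] pos[OF r] unfolding disp_def by (auto intro!: SUP_least)
    then have "disp X f r / ereal (\<phi> r) \<le> ereal (\<phi> r) / ereal (\<phi> r)"
      by (rule ereal_divide_right_mono) (use pos[OF r] in simp)
    then show ?thesis using pos[OF r] by (simp add: one_ereal_def)
  qed
  then have "eventually (\<lambda>r. disp X f r / ereal (\<phi> r) \<le> 1) at_top"
    using eventually_gt_at_top[of "0::real"] by (rule eventually_mono[rotated])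
  then have "Limsup at_top (\<lambda>r. disp X f r / ereal (\<phi> r)) \<le> 1" by (rule Limsup_bounded)
  then have "Limsup at_top (\<lambda>r. disp X f r / ereal (\<phi> r)) < \<infinity>" by (rule le_less_trans) simp
  then show ?thesis using bij unfolding displacement_equivalent_def by blast
qed

text \<open>
  Both Lipschitz constants are replaced by one integer of the form \<open>Suc m\<close>, which later selects
  the slab that excludes the bijection.
\<close>

lemma bilipschitz_inverse_estimates:
  fixes X Y :: "(real ^ 'n) set"
  assumes "bilipschitz_equivalent X Y"
  obtains g and m :: nat where "bij_betw g Y X"
    "\<And>x y. x \<in> Y \<Longrightarrow> y \<in> Y \<Longrightarrow> norm (g x - g y) \<le> real (Suc m) * norm (x - y)"
    "\<And>x y. x \<in> Y \<Longrightarrow> y \<in> Y \<Longrightarrow> norm (x - y) \<le> real (Suc m) * norm (g x - g y)"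
proof -
  obtain f L1 L2 where f: "bij_betw f X Y" "L1-lipschitz_on X f" "L2-lipschitz_on Y (inv_into X f)"
    using assms unfolding bilipschitz_equivalent_def by blast
  define g where "g = inv_into X f"
  define m where "m = nat \<lceil>max L1 L2\<rceil>"
  have m: "L1 \<le> real (Suc m)" "L2 \<le> real (Suc m)" unfolding m_def by linarith+
  have g: "bij_betw g Y X" unfolding g_def using f(1) by (rule bij_betw_inv_into)
  have fg: "f (g y) = y" if "y \<in> Y" for y
    using f(1) that by (simp add: g_def bij_betw_inv_into_right)
  have gX: "g y \<in> X" if "y \<in> Y" for y using g that by (rule bij_betwE[rule_format])
  show ?thesis
  proof (rule that[OF g])
    fix x y assume xy: "x \<in> Y" "y \<in> Y"
    have "norm (g x - g y) \<le> L2 * norm (x - y)"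
      using lipschitz_onD[OF f(3) xy] by (simp add: g_def dist_norm)
    also have "\<dots> \<le> real (Suc m) * norm (x - y)" using m(2) by (rule mult_right_mono) simp
    finally show "norm (g x - g y) \<le> real (Suc m) * norm (x - y)" .
    have "norm (x - y) \<le> L1 * norm (g x - g y)"
      using lipschitz_onD[OF f(2) gX[OF xy(1)] gX[OF xy(2)]] fg xy by (simp add: dist_norm)
    also have "\<dots> \<le> real (Suc m) * norm (g x - g y)" using m(1) by (rule mult_right_mono) simp
    finally show "norm (x - y) \<le> real (Suc m) * norm (g x - g y)" .
  qed
qed

section \<open>Integer and half-integer points\<close>

definition latt :: "int ^ 'n \<Rightarrow> real ^ 'n" where
  "latt z = (\<chi> i. of_int (z $ i))"

text \<open>
  The points of the sets considered below are integer points and integer points shifted by one half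
  in the distinguished direction \<open>a\<close>. The half-integer positions make room for points that are moved
  into cubes already filled with lattice points.
\<close>

definition halfway :: "'n \<Rightarrow> int ^ 'n \<Rightarrow> real ^ 'n" where
  "halfway a z = latt z + axis a (1/2)"

definition cube :: "int ^ 'n \<Rightarrow> int \<Rightarrow> (int ^ 'n) set" where
  "cube c s = {z. \<forall>i. c $ i \<le> z $ i \<and> z $ i < c $ i + s}"

lemma cubeD:
  assumes "z \<in> cube c s"
  shows "c $ i \<le> z $ i" "z $ i < c $ i + s"
  using assms by (auto simp: cube_def)

lemma latt_nth [simp]: "latt z $ i = of_int (z $ i)"
  by (simp add: latt_def)

lemma halfway_nth: "halfway a z $ i = of_int (z $ i) + (if i = a then 1/2 else 0)"
  by (simp add: halfway_def axis_def)

lemma latt_add: "latt (z + w) = latt z + latt w"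
  by (simp add: vec_eq_iff)

lemma latt_diff: "latt (z - w) = latt z - latt w"
  by (simp add: vec_eq_iff)

lemma latt_axis: "latt (axis a s) = axis a (of_int s)"
  by (simp add: vec_eq_iff axis_def)

lemma inj_latt: "inj latt"
  by (auto intro!: injI simp: vec_eq_iff)

lemma inj_halfway: "inj (halfway a)"
  unfolding halfway_def by (rule injI) (metis add_right_cancel injD inj_latt)

lemma of_int_neq_of_int_plus_half: "(of_int x :: real) \<noteq> of_int y + 1/2"
proof
  assume "(of_int x :: real) = of_int y + 1/2"
  then have "(of_int (2 * x) :: real) = of_int (2 * y + 1)" by simp
  then have "2 * x = 2 * y + 1" by (simp only: of_int_eq_iff)
  then show False by presburger
qed

lemma latt_neq_halfway: "latt z \<noteq> halfway a w"
proof
  assume "latt z = halfway a w"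
  then have "latt z $ a = halfway a w $ a" by simp
  then show False using of_int_neq_of_int_plus_half by (simp add: halfway_nth)
qed

lemma norm_le_of_coords:
  fixes x :: "real ^ 'n"
  assumes "\<And>i. \<bar>x $ i\<bar> \<le> B"
  shows "norm x \<le> real CARD('n) * B"
proof -
  have "norm x \<le> (\<Sum>i\<in>UNIV. \<bar>x $ i\<bar>)" by (rule norm_le_l1_cart)
  also have "\<dots> \<le> (\<Sum>i\<in>(UNIV::'n set). B)" by (intro sum_mono assms)
  finally show ?thesis by simp
qed

lemma norm_axis_real: "norm (axis i x :: real ^ 'n) = \<bar>x\<bar>"
  by (simp add: norm_eq_sqrt_inner inner_axis_axis)

lemma half_integral_separated_net:
  fixes X :: "(real ^ 'n) set"
  assumes X: "X \<subseteq> range latt \<union> range (halfway a)" and ev: "\<And>z. even (z $ a) \<Longrightarrow> latt z \<in> X"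
  shows "separated_net X"
  unfolding separated_net_def
proof
  have half: "\<exists>k. x $ j = of_int k / 2" if x: "x \<in> X" for x j
  proof -
    consider z where "x = latt z" | z where "x = halfway a z" using X x by blast
    then show ?thesis
    proof cases
      case (1 z)
      then show ?thesis by (intro exI[of _ "2 * z $ j"]) simp
    next
      case (2 z)
      then show ?thesis
        by (intro exI[of _ "2 * z $ j + (if j = a then 1 else 0)"]) (simp add: halfway_nth add_divide_distrib)
    qed
  qed
  show "separated X"
  proof (rule separatedI[of "1/2"])
    fix x y assume xy: "x \<in> X" "y \<in> X" "x \<noteq> y"
    then obtain j where j: "x $ j \<noteq> y $ j" by (auto simp: vec_eq_iff)
    obtain k l where kl: "x $ j = of_int k / 2" "y $ j = of_int l / 2" using half xy by metis
    then have "k \<noteq> l" using j by auto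
    then have "1 \<le> \<bar>of_int (k - l) :: real\<bar>" by linarith
    moreover have "(x - y) $ j = of_int (k - l) / 2" using kl by (simp add: diff_divide_distrib)
    ultimately have "1/2 \<le> \<bar>(x - y) $ j\<bar>" by (simp only: abs_divide abs_numeral) simp
    then show "1/2 \<le> norm (x - y)" using component_le_norm_cart order_trans by blast
  qed simp
  show "net X"
  proof (rule netI)
    fix x :: "real ^ 'n"
    define z where "z = (\<chi> j. 2 * \<lfloor>x $ j / 2\<rfloor>)"
    have "norm (latt z - x) \<le> real CARD('n) * 2"
    proof (rule norm_le_of_coords)
      fix j
      have "of_int \<lfloor>x $ j / 2\<rfloor> \<le> x $ j / 2" "x $ j / 2 < of_int \<lfloor>x $ j / 2\<rfloor> + 1" by linarith+
      moreover have "(latt z - x) $ j = 2 * of_int \<lfloor>x $ j / 2\<rfloor> - x $ j" by (simp add: z_def)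
      ultimately show "\<bar>(latt z - x) $ j\<bar> \<le> 2" by linarith
    qed
    then show "\<exists>z\<in>X. norm (z - x) \<le> real CARD('n) * 2"
      using ev[of z] by (auto simp: z_def)
  qed
qed

section \<open>Counting integer points in cubes\<close>

lemma int_box_eq_image:
  "{z :: int ^ 'n. \<forall>i. z $ i \<in> I i} = vec_lambda ` (PiE UNIV I)"
proof (intro set_eqI iffI)
  fix z :: "int ^ 'n" assume "z \<in> {z. \<forall>i. z $ i \<in> I i}"
  then have "z = vec_lambda (vec_nth z)" "vec_nth z \<in> PiE UNIV I" by auto
  then show "z \<in> vec_lambda ` (PiE UNIV I)" by blast
qed auto

lemma card_int_box:
  "card {z :: int ^ 'n. \<forall>i. z $ i \<in> I i} = (\<Prod>i\<in>UNIV. card (I i))"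
  unfolding int_box_eq_image
  by (subst card_image) (auto intro!: inj_onI simp: card_PiE vec_lambda_inject)

lemma cube_alt: "cube c s = {z. \<forall>i. z $ i \<in> {c $ i ..< c $ i + s}}"
  by (auto simp: cube_def)

lemma finite_cube: "finite (cube c s)"
  unfolding cube_alt int_box_eq_image by (intro finite_imageI finite_PiE) auto

lemma card_cube:
  fixes c :: "int ^ 'n"
  assumes "0 \<le> s"
  shows "real (card (cube c s)) = of_int s ^ CARD('n)"
  using assms unfolding cube_alt card_int_box by simp

text \<open>
  The cube is a product, so that a condition on one coordinate only changes one factor.
\<close>

lemma card_cube_slice:
  fixes c :: "int ^ 'n"
  assumes "0 \<le> s"
  shows "real (card {z \<in> cube c s. P (z $ j)})
    = real (card {y \<in> {c $ j ..< c $ j + s}. P y}) * of_int s ^ (CARD('n) - 1)"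
proof -
  define I where "I i = (if i = j then {y \<in> {c $ j ..< c $ j + s}. P y} else {c $ i ..< c $ i + s})" for i
  have "{z \<in> cube c s. P (z $ j)} = {z. \<forall>i. z $ i \<in> I i}"
    by (auto simp: cube_def I_def split: if_splits)
  then have "card {z \<in> cube c s. P (z $ j)} = (\<Prod>i\<in>UNIV. card (I i))"
    by (simp add: card_int_box)
  also have "\<dots> = card (I j) * (\<Prod>i\<in>UNIV - {j}. card (I i))"
    by (rule prod.remove) auto
  also have "(\<Prod>i\<in>UNIV - {j}. card (I i)) = (\<Prod>i\<in>UNIV - {j}. nat s)"
    by (rule prod.cong) (auto simp: I_def)
  also have "\<dots> = nat s ^ (CARD('n) - 1)" by (simp add: card_Diff_singleton)
  finally show ?thesis using assms by (simp add: I_def)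
qed

text \<open>
  An interval consisting of full periods meets the residue window in at most the proportion \<open>r / P\<close>.
\<close>

lemma card_residue_window_le:
  fixes c P r s :: int
  assumes "0 < P" "0 \<le> r" "P dvd c" "P dvd s" "0 \<le> s"
  shows "real (card {y \<in> {c ..< c + s}. y mod P < r}) \<le> of_int s * of_int r / of_int P"
proof -
  obtain k where k: "s = P * k" using assms by blast
  have k0: "0 \<le> k" using assms k by (simp add: zero_le_mult_iff)
  have "{y \<in> {c ..< c + s}. y mod P < r} \<subseteq> (\<lambda>(j, x). c + P * j + x) ` ({0..<k} \<times> {0..<r})"
  proof
    fix y assume y: "y \<in> {y \<in> {c ..< c + s}. y mod P < r}"
    have m: "(y - c) mod P = y mod P" using assms(3) by (metis dvd_imp_mod_0 diff_zero mod_diff_right_eq)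
    have "(y - c) div P < k"
    proof -
      have "y - c < k * P" using y k by (auto simp: mult.commute)
      then have "(y - c) div P * P < k * P"
        using assms(1) pos_mod_sign[of P "y - c"] div_mult_mod_eq[of "y - c" P] by linarith
      then show ?thesis using assms(1) by simp
    qed
    moreover have "0 \<le> (y - c) div P" using y assms(1) by (simp add: pos_imp_zdiv_nonneg_iff)
    moreover have "y = c + P * ((y - c) div P) + (y - c) mod P" by simp
    ultimately show "y \<in> (\<lambda>(j, x). c + P * j + x) ` ({0..<k} \<times> {0..<r})"
      using y m assms(1) by (intro image_eqI[where x="((y - c) div P, (y - c) mod P)"]) auto
  qed
  then have "card {y \<in> {c ..< c + s}. y mod P < r} \<le> card ({0..<k} \<times> {0..<r})"
    by (meson finite_SigmaI finite_atLeastLessThan_int surj_card_le)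
  then have "card {y \<in> {c ..< c + s}. y mod P < r} \<le> nat k * nat r" by (simp add: card_cartesian_product)
  then have "real (card {y \<in> {c ..< c + s}. y mod P < r}) \<le> real (nat k * nat r)"
    by (simp only: of_nat_le_iff)
  then have "real (card {y \<in> {c ..< c + s}. y mod P < r}) \<le> of_int k * of_int r"
    using k0 assms(2) by simp
  then show ?thesis using k assms(1) by simp
qed

lemma card_even_int:
  fixes c s :: int
  assumes "even c" "even s" "0 \<le> s"
  shows "real (card {y \<in> {c ..< c + s}. even y}) = of_int s / 2"
proof -
  obtain h where h: "s = 2 * h" using assms by blast
  obtain e where e: "c = 2 * e" using assms by blast
  have "{y \<in> {c ..< c + s}. even y} = (\<lambda>j. 2 * j) ` {e ..< e + h}"
    using h e by (auto elim!: evenE)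
  then have "card {y \<in> {c ..< c + s}. even y} = nat h" by (simp add: card_image inj_on_def)
  then show ?thesis using h assms by simp
qed

lemma card_odd_int:
  fixes c s :: int
  assumes "even c" "even s" "0 \<le> s"
  shows "real (card {y \<in> {c ..< c + s}. odd y}) = of_int s / 2"
proof -
  let ?E = "{y \<in> {c ..< c + s}. even y}"
  have sub: "?E \<subseteq> {c ..< c + s}" by blast
  then have fin: "finite ?E" by (rule finite_subset) simp
  have "{y \<in> {c ..< c + s}. odd y} = {c ..< c + s} - ?E" by blast
  then have "card {y \<in> {c ..< c + s}. odd y} = nat s - card ?E"
    using card_Diff_subset[OF fin sub] by simp
  moreover have "card ?E \<le> nat s" using card_mono[OF _ sub] by simp
  ultimately show ?thesis using card_even_int[OF assms] assms by (simp add: of_nat_diff)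
qed

section \<open>Finding a straight step in a stretched chain\<close>

text \<open>
  A vector of length at most \<open>\<rho>\<close> whose component in direction \<open>u\<close> is almost \<open>\<rho>\<close> is almost
  \<open>\<rho> u\<close>: this is \<open>\<bar>w - \<rho> u\<bar>\<^sup>2 = \<bar>w\<bar>\<^sup>2 - 2 \<rho> \<langle>w, u\<rangle> + \<rho>\<^sup>2\<close>.
\<close>

lemma norm_diff_direction:
  fixes w u :: "'a :: real_inner"
  assumes "norm u = 1" "norm w \<le> \<rho>" "\<rho> - \<delta> \<le> w \<bullet> u"
  shows "(norm (w - \<rho> *\<^sub>R u))\<^sup>2 \<le> 2 * \<rho> * \<delta>"
proof -
  have r: "0 \<le> \<rho>" using assms(2) norm_ge_zero order_trans by blast
  have "(norm (w - \<rho> *\<^sub>R u))\<^sup>2 = (norm w)\<^sup>2 - 2 * \<rho> * (w \<bullet> u) + \<rho>\<^sup>2 * (norm u)\<^sup>2"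
    unfolding power2_norm_eq_inner
    by (simp add: inner_diff_left inner_diff_right inner_commute[of u w] power2_eq_square right_diff_distrib)
  also have "\<dots> \<le> \<rho>\<^sup>2 - 2 * \<rho> * (\<rho> - \<delta>) + \<rho>\<^sup>2"
    using assms r by (intro add_mono diff_mono mult_left_mono power_mono) auto
  finally show ?thesis by (simp add: power2_eq_square algebra_simps)
qed

text \<open>
  For each \<open>t\<close> the vectors \<open>W 0 t, W 1 t, \<dots>\<close> are the steps of a chain. No step is longer than
  \<open>\<rho>\<close>, but each chain advances in the direction \<open>u\<close> almost as far as possible. The total deficit
  over all chains is at most \<open>card T * D\<close>, so that not every even position can contain a step whose
  own deficit exceeds \<open>\<delta>\<close>. Even positions are wanted because the dense cubes sit there.
\<close>

lemma common_straight_step: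
  fixes W :: "nat \<Rightarrow> 't \<Rightarrow> 'a :: real_inner"
  assumes T: "finite T" and u: "norm u = 1" and H: "0 < H"
    and le: "\<And>i t. i < 2 * H - 1 \<Longrightarrow> t \<in> T \<Longrightarrow> norm (W i t) \<le> \<rho>"
    and sum: "\<And>t. t \<in> T \<Longrightarrow> (2 * real H - 1) * \<rho> - D \<le> (\<Sum>i<2 * H - 1. W i t) \<bullet> u"
    and D: "real (card T) * D < real H * \<delta>"
  shows "\<exists>h<H. \<forall>t\<in>T. \<rho> - \<delta> \<le> W (2 * h) t \<bullet> u"
proof (rule ccontr)
  assume "\<not> ?thesis"
  then obtain \<tau> where \<tau>: "\<And>h. h < H \<Longrightarrow> \<tau> h \<in> T \<and> W (2 * h) (\<tau> h) \<bullet> u < \<rho> - \<delta>"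
    by (metis not_le)
  \<comment> \<open>The deficit of a single step, nonnegative by the Cauchy--Schwarz inequality.\<close>
  define \<eta> where "\<eta> i t = \<rho> - W i t \<bullet> u" for i t
  have \<eta>0: "0 \<le> \<eta> i t" if "i < 2 * H - 1" "t \<in> T" for i t
  proof -
    have "W i t \<bullet> u \<le> norm (W i t) * norm u" by (rule norm_cauchy_schwarz)
    then show ?thesis using le[OF that] u by (simp add: \<eta>_def)
  qed
  have "real H * \<delta> = (\<Sum>h<H. \<delta>)" by simp
  also have "\<dots> \<le> (\<Sum>h<H. \<Sum>t\<in>T. \<eta> (2 * h) t)"
  proof (rule sum_mono)
    fix h assume "h \<in> {..<H}"
    then have h: "h < H" by simp
    have "\<delta> \<le> \<eta> (2 * h) (\<tau> h)" using \<tau>[OF h] by (simp add: \<eta>_def)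
    also have "\<dots> \<le> (\<Sum>t\<in>T. \<eta> (2 * h) t)"
      using \<tau>[OF h] h \<eta>0 T by (intro member_le_sum) auto
    finally show "\<delta> \<le> (\<Sum>t\<in>T. \<eta> (2 * h) t)" .
  qed
  also have "\<dots> = (\<Sum>t\<in>T. \<Sum>h<H. \<eta> (2 * h) t)" by (rule sum.swap)
  also have "\<dots> \<le> (\<Sum>t\<in>T. \<Sum>i<2 * H - 1. \<eta> i t)"
  proof (rule sum_mono)
    fix t assume t: "t \<in> T"
    have "(\<Sum>h<H. \<eta> (2 * h) t) = (\<Sum>i\<in>(\<lambda>h. 2 * h) ` {..<H}. \<eta> i t)"
      by (subst sum.reindex) (auto simp: inj_on_def)
    also have "\<dots> \<le> (\<Sum>i<2 * H - 1. \<eta> i t)"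
      using t \<eta>0 by (intro sum_mono2) auto
    finally show "(\<Sum>h<H. \<eta> (2 * h) t) \<le> (\<Sum>i<2 * H - 1. \<eta> i t)" .
  qed
  also have "\<dots> \<le> (\<Sum>t\<in>T. D)"
  proof (rule sum_mono)
    fix t assume t: "t \<in> T"
    have "(\<Sum>i<2 * H - 1. \<eta> i t) = (2 * real H - 1) * \<rho> - (\<Sum>i<2 * H - 1. W i t) \<bullet> u"
      using H by (simp add: \<eta>_def sum_subtractf inner_sum_left of_nat_diff)
    then show "(\<Sum>i<2 * H - 1. \<eta> i t) \<le> D" using sum[OF t] by simp
  qed
  finally show False using D by simp
qed

section \<open>Checkered point sets and their densities\<close>

text \<open>
  The \<open>b\<close>-coordinate of a point decides on which scale it lives. The strips of scale \<open>j\<close> are periodic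
  with period \<open>2 * N ^ Suc j\<close> and have thickness \<open>2 * M * N ^ j\<close>, and the finest scale wins. As the
  coordinate \<open>a\<close> is not involved, moving a point in direction \<open>a\<close> does not change its scale.
\<close>

definition fine_window :: "int \<Rightarrow> int \<Rightarrow> nat \<Rightarrow> int \<Rightarrow> bool" where
  "fine_window M N i y \<longleftrightarrow> (\<exists>j<i. y mod (2 * N ^ Suc j) < 2 * M * N ^ j)"

definition active :: "int \<Rightarrow> int \<Rightarrow> nat \<Rightarrow> int \<Rightarrow> bool" where
  "active M N i y \<longleftrightarrow> y mod (2 * N ^ Suc i) < 2 * M * N ^ i \<and> \<not> fine_window M N i y"

text \<open>
  In the cubes with even index all integer points are present, together with additional half-integer
  points above the odd ones: density \<open>3/2\<close>. In the cubes with odd index only the integer points with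
  even \<open>a\<close>-coordinate are left: density \<open>1/2\<close>. The integer points with even \<open>a\<close>-coordinate are
  present everywhere; all lengths used below are even, so that the corners of the grids belong
  to \<open>X\<close>.
\<close>

definition checkered ::
  "'n \<Rightarrow> 'n \<Rightarrow> int \<Rightarrow> int \<Rightarrow> nat \<Rightarrow> int \<Rightarrow> (real ^ 'n) set \<Rightarrow> bool" where
  "checkered a b M N n R X \<longleftrightarrow>
     X \<subseteq> range latt \<union> range (halfway a) \<and>
     (\<forall>z. even (z $ a) \<longrightarrow> latt z \<in> X) \<and>
     (\<forall>z. \<forall>i<n. R \<le> z $ a \<and> z $ a < R + 2 * M * N ^ n \<and> active M N i (z $ b) \<longrightarrow>
        (if even (z $ a div (2 * M * N ^ i))
         then latt z \<in> X \<and> (odd (z $ a) \<longrightarrow> halfway a z \<in> X)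
         else halfway a z \<notin> X \<and> (odd (z $ a) \<longrightarrow> latt z \<notin> X)))"

text \<open>
  The inequality \<open>10 * n * M \<le> N\<close> says that the strips of all finer scales together fill at most a
  tenth of a cube.
\<close>

locale checkered_bijection =
  fixes a b :: "'n :: finite" and M N :: int and n :: nat and R :: int
    and X :: "(real ^ 'n) set" and f :: "real ^ 'n \<Rightarrow> real ^ 'n" and L :: real
  assumes ab: "a \<noteq> b" and M0: "0 < M" and N0: "0 < N" and MN: "2 * M dvd N" and sparse: "10 * int n * M \<le> N"
    and checkered: "checkered a b M N n R X"
    and bij: "bij_betw f X (range latt)"
    and L1: "1 \<le> L"
    and lip: "\<And>x y. x \<in> X \<Longrightarrow> y \<in> X \<Longrightarrow> norm (f x - f y) \<le> L * norm (x - y)"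
    and colip: "\<And>x y. x \<in> X \<Longrightarrow> y \<in> X \<Longrightarrow> norm (x - y) \<le> L * norm (f x - f y)"
begin

abbreviation side :: "nat \<Rightarrow> int" where "side i \<equiv> 2 * M * N ^ i"
abbreviation mesh :: "nat \<Rightarrow> int" where "mesh i \<equiv> 2 * N ^ i"

lemma side_pos: "0 < side i" using M0 N0 by simp
lemma mesh_pos: "0 < mesh i" using N0 by simp

lemma even_latt: "even (z $ a) \<Longrightarrow> latt z \<in> X"
  using checkered by (auto simp: checkered_def)

lemma X_form: "x \<in> X \<Longrightarrow> \<exists>z. x = latt z \<or> x = halfway a z"
  using checkered by (auto simp: checkered_def)

text \<open>
  The strips of scale \<open>j < i\<close> occupy the proportion \<open>M / N\<close> of the cube, because its position and its
  side in direction \<open>b\<close> are multiples of their period; summing over \<open>j\<close> gives at most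
  \<open>n * M / N \<le> 1/10\<close>.
\<close>

lemma card_fine_le:
  assumes "i < n" "mesh i dvd c $ b"
  shows "real (card {z \<in> cube c (side i). fine_window M N i (z $ b)}) \<le> of_int (side i) ^ CARD('n) / 10"
proof -
  let ?s = "side i"
  let ?Y = "\<lambda>j. {y \<in> {c $ b ..< c $ b + ?s}. y mod (2 * N ^ Suc j) < 2 * M * N ^ j}"
  have Y: "real (card (?Y j)) \<le> of_int ?s * (of_int M / of_int N)" if "j < i" for j
  proof -
    have d: "2 * N ^ Suc j dvd mesh i" using that by (intro mult_dvd_mono le_imp_power_dvd) auto
    have "real (card (?Y j)) \<le> of_int ?s * of_int (2 * M * N ^ j) / of_int (2 * N ^ Suc j)"
      by (rule card_residue_window_le)
         (use M0 N0 d assms(2) in \<open>auto intro: dvd_trans dvd_mult2 dvd_mult simp: mult.assoc mult.left_commute[of 2 M]\<close>)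
    also have "\<dots> = of_int ?s * (of_int M / of_int N)" using N0 by (simp add: field_simps)
    finally show ?thesis .
  qed
  have "{y \<in> {c $ b ..< c $ b + ?s}. fine_window M N i y} = (\<Union>j<i. ?Y j)"
    by (auto simp: fine_window_def)
  then have "real (card {y \<in> {c $ b ..< c $ b + ?s}. fine_window M N i y}) \<le> (\<Sum>j<i. real (card (?Y j)))"
    using card_UN_le[of "{..<i}" ?Y] by (simp flip: of_nat_sum)
  also have "\<dots> \<le> (\<Sum>j<i. of_int ?s * (of_int M / of_int N))" by (intro sum_mono Y) auto
  also have "\<dots> = of_int ?s * (real i * of_int M / of_int N)" by simp
  also have "\<dots> \<le> of_int ?s * (1 / 10)"
  proof (rule mult_left_mono)
    have "10 * int i * M \<le> 10 * int n * M" using assms(1) M0 by (intro mult_right_mono) auto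
    then have "10 * int i * M \<le> N" using sparse by linarith
    then have "(of_int (10 * int i * M) :: real) \<le> of_int N" by (simp only: of_int_le_iff)
    then show "real i * of_int M / of_int N \<le> 1 / 10" using N0 by (simp add: field_simps)
  qed (use M0 N0 in simp)
  finally have *: "real (card {y \<in> {c $ b ..< c $ b + ?s}. fine_window M N i y}) \<le> of_int ?s / 10" by simp
  have p: "of_int ?s ^ CARD('n) = (of_int ?s :: real) * of_int ?s ^ (CARD('n) - 1)"
    by (metis power_eq_if zero_less_card_finite less_irrefl)
  have "real (card {z \<in> cube c ?s. fine_window M N i (z $ b)}) \<le> of_int ?s / 10 * of_int ?s ^ (CARD('n) - 1)"
    unfolding card_cube_slice[OF less_imp_le[OF side_pos]]
    by (rule mult_right_mono[OF *]) (use M0 N0 in simp)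
  then show ?thesis unfolding p by simp
qed

lemma card_parity_cube:
  assumes "even (c $ a)"
  shows "real (card {z \<in> cube c (side i). even (z $ a)}) = of_int (side i) ^ CARD('n) / 2"
    and "real (card {z \<in> cube c (side i). odd (z $ a)}) = of_int (side i) ^ CARD('n) / 2"
proof -
  have p: "of_int (side i) ^ CARD('n) = (of_int (side i) :: real) * of_int (side i) ^ (CARD('n) - 1)"
    by (metis power_eq_if zero_less_card_finite less_irrefl)
  have s: "0 \<le> side i" "even (side i)" using side_pos[of i] by auto
  show "real (card {z \<in> cube c (side i). even (z $ a)}) = of_int (side i) ^ CARD('n) / 2"
    unfolding card_cube_slice[OF s(1)] card_even_int[OF assms s(2,1)] p by simp
  show "real (card {z \<in> cube c (side i). odd (z $ a)}) = of_int (side i) ^ CARD('n) / 2"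
    unfolding card_cube_slice[OF s(1), where P = "\<lambda>y. odd y"] card_odd_int[OF assms s(2,1)] p by simp
qed

text \<open>
  The points of a dense cube that are not influenced by a finer scale; they all belong to \<open>X\<close>
  (\<open>heavy_subset\<close>).
\<close>

definition heavy :: "nat \<Rightarrow> int ^ 'n \<Rightarrow> (real ^ 'n) set" where
  "heavy i c = latt ` {z \<in> cube c (side i). \<not> fine_window M N i (z $ b)}
     \<union> halfway a ` {z \<in> cube c (side i). \<not> fine_window M N i (z $ b) \<and> odd (z $ a)}"

definition points_over :: "(int ^ 'n) set \<Rightarrow> (real ^ 'n) set" where
  "points_over E = X \<inter> (latt ` E \<union> halfway a ` E)"

text \<open>
  The cube of side \<open>side i\<close> with corner \<open>c\<close> lies in the slab and inside a strip of scale \<open>i\<close>, and is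
  one of the cubes into which this strip is cut. Whether it is dense or sparse depends on the parity
  of \<open>c $ a div side i\<close>.
\<close>

definition in_strip :: "nat \<Rightarrow> int ^ 'n \<Rightarrow> bool" where
  "in_strip i c \<longleftrightarrow> i < n \<and> mesh i dvd c $ b \<and> R \<le> c $ a \<and> c $ a + side i \<le> R + side n \<and>
     side i dvd c $ a \<and> (\<forall>y. c $ b \<le> y \<and> y < c $ b + side i \<longrightarrow> y mod (mesh (Suc i)) < side i)"

lemma strip_div:
  assumes "in_strip i c" "z \<in> cube c (side i)"
  shows "z $ a div side i = c $ a div side i"
proof -
  obtain k where k: "c $ a = side i * k" using assms by (auto simp: in_strip_def)
  have "side i * k \<le> z $ a" "z $ a < side i * k + side i" using cubeD[OF assms(2), of a] k by simp_all
  then have "z $ a div side i = k" using side_pos[of i]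
    by (intro int_div_pos_eq[of _ _ _ "z $ a - side i * k"]) auto
  then show ?thesis using k M0 N0 by simp
qed

lemma strip_active:
  assumes "in_strip i c" "z \<in> cube c (side i)" "\<not> fine_window M N i (z $ b)"
  shows "i < n" "R \<le> z $ a" "z $ a < R + 2 * M * N ^ n" "active M N i (z $ b)"
  using assms by (auto simp: in_strip_def cube_def active_def dest!: spec[of _ a])

lemma heavy_subset:
  assumes "in_strip i c" "even (c $ a div side i)"
  shows "heavy i c \<subseteq> X"
proof -
  have "latt z \<in> X \<and> (odd (z $ a) \<longrightarrow> halfway a z \<in> X)"
    if "z \<in> cube c (side i)" "\<not> fine_window M N i (z $ b)" for z
    using checkered strip_active[OF assms(1) that] strip_div[OF assms(1) that(1)] assms(2)
    by (auto simp: checkered_def)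
  then show ?thesis by (auto simp: heavy_def)
qed

text \<open>
  The density \<open>3/2\<close> loses at most \<open>1/10\<close> twice, once for the integer points and once for the
  half-integer points above odd coordinates.
\<close>

lemma card_heavy:
  assumes "in_strip i c"
  shows "13 / 10 * of_int (side i) ^ CARD('n) \<le> real (card (heavy i c))"
proof -
  let ?C = "cube c (side i)" and ?f = "\<lambda>z. fine_window M N i (z $ b)"
  have ev: "even (c $ a)" using assms by (auto simp: in_strip_def elim!: dvdE)
  have fl: "real (card {z \<in> ?C. ?f z}) \<le> of_int (side i) ^ CARD('n) / 10"
    using card_fine_le assms by (simp add: in_strip_def)
  have fin: "finite {z \<in> ?C. P z}" for P by (rule finite_subset[OF _ finite_cube]) auto
  have "card ?C \<le> card ({z \<in> ?C. \<not> ?f z} \<union> {z \<in> ?C. ?f z})"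
    using fin by (intro card_mono) auto
  also have "\<dots> \<le> card {z \<in> ?C. \<not> ?f z} + card {z \<in> ?C. ?f z}" by (rule card_Un_le)
  finally have 1: "of_int (side i) ^ CARD('n) - of_int (side i) ^ CARD('n) / 10 \<le> real (card {z \<in> ?C. \<not> ?f z})"
    using fl card_cube[OF less_imp_le[OF side_pos], of c i] by linarith
  have "card {z \<in> ?C. odd (z $ a)} \<le> card ({z \<in> ?C. \<not> ?f z \<and> odd (z $ a)} \<union> {z \<in> ?C. ?f z})"
    using fin by (intro card_mono) auto
  also have "\<dots> \<le> card {z \<in> ?C. \<not> ?f z \<and> odd (z $ a)} + card {z \<in> ?C. ?f z}" by (rule card_Un_le)
  finally have 2: "of_int (side i) ^ CARD('n) / 2 - of_int (side i) ^ CARD('n) / 10 \<le> real (card {z \<in> ?C. \<not> ?f z \<and> odd (z $ a)})"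
    using fl card_parity_cube(2)[OF ev, of i] by linarith
  have "card (heavy i c) = card {z \<in> ?C. \<not> ?f z} + card {z \<in> ?C. \<not> ?f z \<and> odd (z $ a)}"
    unfolding heavy_def using fin latt_neq_halfway
    by (subst card_Un_disjoint)
       (fastforce simp: card_image inj_on_subset[OF inj_latt] inj_on_subset[OF inj_halfway])+
  then show ?thesis using 1 2 by simp
qed

text \<open>
  A tenth of the cube may be disturbed by finer scales and the enlargement adds at most another tenth,
  each with at most two points of \<open>X\<close> per integer point: \<open>1/2 + 2 * (1/10 + 1/10) = 9/10\<close>.
\<close>

lemma card_light:
  assumes t: "in_strip i c" and o: "odd (c $ a div side i)" and E: "finite E" "cube c (side i) \<subseteq> E"
    and cE: "real (card E) \<le> 11 / 10 * of_int (side i) ^ CARD('n)"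
  shows "real (card (points_over E)) \<le> 9 / 10 * of_int (side i) ^ CARD('n)"
proof -
  let ?C = "cube c (side i)" and ?f = "\<lambda>z. fine_window M N i (z $ b)"
  let ?B = "{z \<in> ?C. ?f z} \<union> (E - ?C)"
  have ev: "even (c $ a)" using t by (auto simp: in_strip_def elim!: dvdE)
  have fl: "real (card {z \<in> ?C. ?f z}) \<le> of_int (side i) ^ CARD('n) / 10"
    using card_fine_le t by (simp add: in_strip_def)
  have fin: "finite {z \<in> ?C. P z}" for P by (rule finite_subset[OF _ finite_cube]) auto
  have l: "halfway a z \<notin> X \<and> (odd (z $ a) \<longrightarrow> latt z \<notin> X)"
    if "z \<in> ?C" "\<not> ?f z" for z
    using checkered strip_active[OF t that] strip_div[OF t that(1)] o
    by (auto simp: checkered_def)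
  have "points_over E \<subseteq> latt ` {z \<in> ?C. even (z $ a)} \<union> (latt ` ?B \<union> halfway a ` ?B)"
    using l by (fastforce simp: points_over_def)
  then have "card (points_over E) \<le> card (latt ` {z \<in> ?C. even (z $ a)} \<union> (latt ` ?B \<union> halfway a ` ?B))"
    using fin E(1) by (intro card_mono) auto
  also have "\<dots> \<le> card {z \<in> ?C. even (z $ a)} + (card ?B + card ?B)"
    using fin E(1)
    by (intro order_trans[OF card_Un_le] add_mono card_image_le) auto
  finally have 1: "real (card (points_over E)) \<le> of_int (side i) ^ CARD('n) / 2 + 2 * real (card ?B)"
    using card_parity_cube(1)[OF ev, of i] by linarith
  have "card ?B \<le> card {z \<in> ?C. ?f z} + card (E - ?C)" by (rule card_Un_le)
  moreover have "card (E - ?C) = card E - card ?C" using E finite_cube by (intro card_Diff_subset)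
  moreover have "card ?C \<le> card E" using E by (intro card_mono)
  ultimately have "real (card ?B) \<le> of_int (side i) ^ CARD('n) / 5"
    using fl cE card_cube[OF less_imp_le[OF side_pos], of c i] by simp
  then show ?thesis using 1 by simp
qed

text \<open>
  If \<open>f (q + s e\<^sub>a) - f q\<close> is almost equal to \<open>v\<close> for all grid points \<open>q\<close> of the cube, then
  \<open>g x = f\<inverse> (f x + w)\<close> moves the points of the cube almost by \<open>s e\<^sub>a\<close>, where \<open>w\<close> is a lattice vector
  close to \<open>v\<close>. The map \<open>g\<close> exists and is injective because \<open>f\<close> is a bijection onto the lattice.
\<close>

lemma transport:
  assumes t: "in_strip i c" and even_c: "even (c $ a div side i)" and div: "mesh i dvd c $ a"
    and W: "\<And>t. t \<in> cube 0 M \<Longrightarrow>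
      norm (f (latt (c + mesh i *s t + axis a (side i))) - f (latt (c + mesh i *s t)) - v) \<le> \<epsilon> * of_int (side i)"
    and \<kappa>: "(L\<^sup>2 + 1) * real CARD('n) * of_int (mesh i) + 2 * L * \<epsilon> * of_int (side i) \<le> of_int \<kappa>"
  shows "card (heavy i c) \<le> card (points_over (cube (c + axis a (side i) - (\<chi> j. \<kappa>)) (side i + 2 * \<kappa>)))"
    (is "_ \<le> card (points_over ?E)")
proof -
  let ?s = "side i" and ?m = "mesh i" and ?d = "real CARD('n)"
  define F where "F z = f (latt z)" for z
  \<comment> \<open>The increment at the corner of the cube serves as the lattice vector close to \<open>v\<close>.\<close>
  define w where "w = F (c + axis a ?s) - F c"
  have evm: "even (c $ a)" using t by (auto simp: in_strip_def elim!: dvdE)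
  have FX: "latt z \<in> X" if "even (z $ a)" for z using even_latt that .
  have Fl: "F z \<in> range latt" if "even (z $ a)" for z
    using bij FX[OF that] by (auto simp: F_def bij_betw_def)
  obtain z1 z2 where z12: "F (c + axis a ?s) = latt z1" "F c = latt z2"
    using Fl[of "c + axis a ?s"] Fl[of c] evm by (auto simp: axis_def)
  then have w: "w = latt (z1 - z2)" by (simp add: w_def latt_diff)
  define g where "g x = inv_into X f (f x + w)" for x
  have rng: "f x + w \<in> f ` X" if x: "x \<in> X" for x
  proof -
    obtain z where "f x = latt z" using bij x by (auto simp: bij_betw_def)
    then have "f x + w = latt (z + (z1 - z2))" by (simp add: w latt_add)
    then show ?thesis using bij by (auto simp: bij_betw_def)
  qed
  have gX: "g x \<in> X" and fg: "f (g x) = f x + w" if "x \<in> X" for x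
    using rng[OF that] by (auto simp: g_def inv_into_into f_inv_into_f)
  have sub: "heavy i c \<subseteq> X" using heavy_subset t even_c .
  have inj: "inj_on g (heavy i c)"
  proof (rule inj_onI)
    fix x y assume xy: "x \<in> heavy i c" "y \<in> heavy i c" "g x = g y"
    then have "f x = f y" using fg sub by (metis add_right_cancel subsetD)
    then show "x = y" using bij sub xy by (auto simp: bij_betw_def dest: inj_onD)
  qed
  have W0: "norm (w - v) \<le> \<epsilon> * of_int ?s"
    using W[of 0] M0 by (simp add: w_def F_def cube_def)
  have near: "norm (g x - (x + axis a (of_int ?s))) \<le> of_int \<kappa>"
    if x: "x \<in> X" and z: "z \<in> cube c ?s" and xz: "x = latt z \<or> x = halfway a z" for x z
  proof -
    \<comment> \<open>The grid point \<open>q\<close> below \<open>z\<close>; it is at distance at most \<open>d * mesh i\<close> from \<open>x\<close>.\<close>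
    define t where "t = (\<chi> j. (z $ j - c $ j) div ?m)"
    define q where "q = c + ?m *s t"
    have tc: "t \<in> cube 0 M"
    proof -
      have "0 \<le> (z $ j - c $ j) div ?m \<and> (z $ j - c $ j) div ?m < M" for j
      proof -
        have "0 \<le> z $ j - c $ j" "z $ j - c $ j < M * ?m" using cubeD[OF z, of j] by simp_all
        then show ?thesis using mesh_pos[of i]
          by (smt (verit) div_mult_mod_eq pos_mod_sign mult_right_mono mult.commute pos_imp_zdiv_nonneg_iff)
      qed
      then show ?thesis by (simp add: cube_def t_def)
    qed
    have qz: "0 \<le> z $ j - q $ j \<and> z $ j - q $ j \<le> ?m - 1" for j
    proof -
      have "z $ j - q $ j = (z $ j - c $ j) mod ?m"
        by (simp add: q_def t_def minus_div_mult_eq_mod [symmetric] algebra_simps)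
      then show ?thesis using mesh_pos[of i] by (smt (verit) pos_mod_sign pos_mod_bound)
    qed
    have qa: "even (q $ a)" "even ((q + axis a ?s) $ a)" using evm by (auto simp: q_def axis_def)
    have xq: "norm (x - latt q) \<le> ?d * of_int ?m"
    proof (rule norm_le_of_coords)
      fix j
      have "(0::real) \<le> of_int (z $ j - q $ j)" "(of_int (z $ j - q $ j)::real) \<le> of_int (?m - 1)"
        using qz[of j] by (simp_all only: of_int_le_iff of_int_0_le_iff)
      then show "\<bar>(x - latt q) $ j\<bar> \<le> of_int ?m" using xz by (auto simp: halfway_nth abs_le_iff)
    qed
    have "norm (f x - F q) \<le> L * norm (x - latt q)" unfolding F_def by (rule lip) (use x FX qa in auto)
    also have "\<dots> \<le> L * (?d * of_int ?m)" using xq L1 by (intro mult_left_mono) auto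
    finally have 1: "norm (f x - F q) \<le> L * (?d * of_int ?m)" .
    have "norm (F (q + axis a ?s) - F q - v) \<le> \<epsilon> * of_int ?s"
      using W[OF tc] by (simp add: F_def q_def)
    then have 2: "norm (F q + w - F (q + axis a ?s)) \<le> 2 * \<epsilon> * of_int ?s"
      using W0 norm_triangle_ineq4[of "w - v" "F (q + axis a ?s) - F q - v"] by (simp add: algebra_simps)
    have "norm (f (g x) - F (q + axis a ?s)) \<le> L * (?d * of_int ?m) + 2 * \<epsilon> * of_int ?s"
      using norm_triangle_ineq[of "f x - F q" "F q + w - F (q + axis a ?s)"] 1 2 fg[OF x]
      by (simp add: algebra_simps)
    then have "L * norm (f (g x) - F (q + axis a ?s)) \<le> L * (L * (?d * of_int ?m) + 2 * \<epsilon> * of_int ?s)"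
      using L1 by (intro mult_left_mono) auto
    moreover have "norm (g x - latt (q + axis a ?s)) \<le> L * norm (f (g x) - F (q + axis a ?s))"
      unfolding F_def by (rule colip) (use gX x FX qa in auto)
    ultimately have 3: "norm (g x - latt (q + axis a ?s)) \<le> L\<^sup>2 * ?d * of_int ?m + 2 * L * \<epsilon> * of_int ?s"
      by (simp add: algebra_simps power2_eq_square)
    have "norm (g x - (x + axis a (of_int ?s))) \<le> norm (g x - latt (q + axis a ?s)) + norm (x - latt q)"
      using norm_triangle_ineq4[of "g x - latt (q + axis a ?s)" "x - latt q"]
      by (simp add: latt_add latt_axis algebra_simps)
    also have "\<dots> \<le> (L\<^sup>2 + 1) * ?d * of_int ?m + 2 * L * \<epsilon> * of_int ?s"
      using 3 xq by (simp add: algebra_simps)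
    finally show ?thesis using \<kappa> by linarith
  qed
  have "g ` heavy i c \<subseteq> points_over ?E"
  proof
    fix y assume "y \<in> g ` heavy i c"
    then obtain x where x: "x \<in> heavy i c" "y = g x" by blast
    then obtain z where z: "z \<in> cube c ?s" and xz: "x = latt z \<or> x = halfway a z"
      by (auto simp: heavy_def)
    have yX: "y \<in> X" using x sub gX by auto
    then obtain z' where z': "y = latt z' \<or> y = halfway a z'" using X_form by blast
    have "z' \<in> ?E"
      unfolding cube_def
    proof (rule CollectI, rule allI)
      fix j
      let ?e = "axis a ?s $ j :: int"
      have "\<bar>(y - (x + axis a (of_int ?s))) $ j\<bar> \<le> of_int \<kappa>"
        using near[of x z] x sub z xz component_le_norm_cart order_trans by blast
      then have "\<bar>y $ j - x $ j - of_int ?e\<bar> \<le> of_int \<kappa>"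
        by (simp add: axis_def split: if_splits)
      moreover have "of_int (z' $ j) \<le> y $ j \<and> y $ j \<le> of_int (z' $ j) + 1/2" 
        using z' by (auto simp: halfway_nth)
      moreover have "of_int (z $ j) \<le> x $ j \<and> x $ j \<le> of_int (z $ j) + 1/2" 
        using xz by (auto simp: halfway_nth)
      ultimately have "\<bar>of_int (z' $ j - z $ j - ?e) :: real\<bar> \<le> of_int \<kappa> + 1/2"
        unfolding of_int_diff by linarith
      then have "\<bar>z' $ j - z $ j - ?e\<bar> \<le> \<kappa>" by linarith
      then show "(c + axis a ?s - (\<chi> j. \<kappa>)) $ j \<le> z' $ j \<and>
          z' $ j < (c + axis a ?s - (\<chi> j. \<kappa>)) $ j + (?s + 2 * \<kappa>)"
        using z by (auto simp: cube_def abs_le_iff dest!: spec[of _ j])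
    qed
    then show "y \<in> points_over ?E" using yX z' by (auto simp: points_over_def)
  qed
  moreover have "finite (points_over ?E)" using finite_cube by (auto simp: points_over_def)
  ultimately show ?thesis using inj by (metis card_inj_on_le)
qed

end

section \<open>Stretching grows from scale to scale\<close>

text \<open>
  The constants are chosen in the order \<open>Q, \<epsilon>, M, \<delta>, k, n, N\<close>. The dense cube is compared with the
  sparse cube enlarged by \<open>side i / Q\<close> on all sides; \<open>\<epsilon>\<close> and \<open>1 / M\<close> bound the errors of
  \<open>transport\<close> by this amount; \<open>\<delta>\<close> is the deficit up to which a step counts as straight; and the
  last inequality is the pigeonhole condition for the \<open>N / 2\<close> dense cubes along a segment and the
  \<open>M ^ d\<close> grid points of each.
\<close>

locale checkered_step = checkered_bijection a b M N n R X f L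
  for a b :: "'n :: finite" and M N n R X f L +
  fixes Q :: int and \<epsilon> \<delta> k :: real
  assumes Q: "0 < Q" "Q dvd M" "(1 + 2 / of_int Q) ^ CARD('n) \<le> (11 / 10 :: real)"
    and eps: "0 < \<epsilon>" "(L\<^sup>2 + 1) * real CARD('n) / of_int M + 2 * L * \<epsilon> \<le> 1 / of_int Q"
    and delta: "4 * L * \<delta> \<le> \<epsilon>\<^sup>2"
    and k: "0 < k" "k \<le> 1"
    and pigeonhole: "of_int M ^ CARD('n) * (k * L * of_int N + L * (2 * real CARD('n) + 1)) < of_int N / 2 * \<delta>"
begin

lemma side_le_mesh: "side i \<le> mesh (Suc i)"
proof -
  have "2 * M \<le> N" using MN N0 by (rule zdvd_imp_le)
  then have "2 * M * N ^ i \<le> N * N ^ i" using N0 by (intro mult_right_mono) auto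
  then show ?thesis using N0 by simp
qed

lemma double_side_dvd: "2 * side i dvd mesh (Suc i)"
proof -
  obtain w where "N = 2 * M * w" using MN by blast
  then have "mesh (Suc i) = 2 * side i * w" by simp
  then show ?thesis by (rule dvdI)
qed

lemma even_of_mesh_dvd: "mesh i dvd y \<Longrightarrow> even y"
  by (metis dvd_mult_left)

lemma mesh_dvd_Suc: "mesh (Suc i) dvd y \<Longrightarrow> mesh i dvd y"
  by (erule dvd_trans[rotated]) simp

text \<open>
  The heart of the argument: if no finer segment were stretched by the factor \<open>(1 + k) * A\<close>,
  the points of some dense cube could be transported into the neighbouring sparse one.
\<close>

lemma stretch_step:
  assumes i: "i < n" and p: "\<And>j. mesh (Suc i) dvd p $ j"
    and pR: "R \<le> p $ a" "p $ a + side (Suc i) \<le> R + side n"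
    and A0: "0 < A" and A: "A * of_int (side (Suc i)) \<le> norm (f (latt (p + axis a (side (Suc i)))) - f (latt p))"
  shows "\<exists>q. (\<forall>j. mesh i dvd q $ j) \<and> R \<le> q $ a \<and> q $ a + side i \<le> R + side n \<and>
    (1 + k) * A * of_int (side i) \<le> norm (f (latt (q + axis a (side i))) - f (latt q))"
proof (rule ccontr)
  assume neg: "\<not> ?thesis"
  define F where "F z = f (latt z)" for z
  define H where "H = nat (N div 2)"
  define s m l where "s = side i" and "m = mesh i" and "l = side (Suc i)"
  define d where "d = real CARD('n)"
  have s0: "0 < s" and m0: "0 < m" using side_pos mesh_pos by (simp_all add: s_def m_def)
  have sm: "s = M * m" and ls: "l = N * s" by (simp_all add: s_def m_def l_def)
  have pN: "p $ a + N * s \<le> R + side n" using pR(2) unfolding l_def[symmetric] ls .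
  have evN: "even N" using MN by (metis dvd_mult_left)
  have NH: "N = 2 * int H" using evN N0 by (auto simp: H_def elim!: evenE)
  have H0: "0 < H" using N0 NH by simp
  have Flip: "norm (F z - F w) \<le> L * norm (latt (z - w))" if "even (z $ a)" "even (w $ a)" for z w
    unfolding F_def latt_diff by (rule lip) (use even_latt that in auto)
  have pa: "even (p $ a)" using even_of_mesh_dvd[OF p] .
  have evs: "even s" by (simp add: s_def)
  have evm: "even m" by (simp add: m_def)
  have nax: "norm (latt (axis a x) :: real ^ 'n) = \<bar>of_int x\<bar>" for x
    by (simp add: latt_axis norm_axis_real)
  define V where "V = F (p + axis a l) - F p"
  have Vl: "A * of_int l \<le> norm V" using A by (simp add: V_def F_def l_def)
  have l0: "0 < l" using M0 N0 by (simp add: l_def)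
  have "norm V \<le> L * norm (latt (p + axis a l - p))"
    unfolding V_def by (rule Flip) (use pa evs ls in \<open>auto simp: axis_def\<close>)
  then have "norm V \<le> L * of_int l" using nax l0 by simp
  then have "A * of_int l \<le> L * of_int l" using Vl by linarith
  then have AL: "A \<le> L" by (rule mult_right_le_imp_le) (use l0 in simp)
  \<comment> \<open>All steps are compared with the direction in which \<open>f\<close> moves the long segment.\<close>
  define u where "u = V /\<^sub>R norm V"
  have V0: "0 < norm V" using Vl A0 l0 by (smt (verit) mult_pos_pos of_int_pos)
  then have u1: "norm u = 1" by (simp add: u_def)
  have Vu: "V \<bullet> u = norm V" using V0 by (simp add: u_def dot_square_norm power2_eq_square)
  \<comment> \<open>The start of step \<open>h\<close>, translated by the grid vector \<open>m t\<close>. Only the steps \<open>h < N - 1\<close> are used,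
    so that their translates still end inside the strip.\<close>
  define q where "q h t = p + axis a (int h * s) + m *s t" for h t
  have q_Suc: "q (Suc h) t = q h t + axis a s" for h t
    by (simp add: q_def vec_eq_iff axis_def algebra_simps)
  define W where "W h t = F (q h t + axis a s) - F (q h t)" for h t
  have evq: "even (q h t $ a)" for h t using pa evs evm by (simp add: q_def axis_def)
  define \<rho> where "\<rho> = (1 + k) * A * of_int s"
  have tm: "norm (latt (m *s t)) \<le> d * of_int s" if "t \<in> cube 0 M" for t :: "int ^ 'n"
    unfolding d_def
  proof (rule norm_le_of_coords)
    fix j
    have "0 \<le> m * t $ j" "m * t $ j \<le> m * M" using cubeD[OF that, of j] m0 by simp_all
    then have "\<bar>m * t $ j\<bar> \<le> s" by (simp add: sm mult.commute)
    then show "\<bar>latt (m *s t) $ j\<bar> \<le> of_int s" by (metis latt_nth of_int_abs of_int_le_iff vector_smult_component)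
  qed
  have W_le: "norm (W h t) \<le> \<rho>" if h: "h < 2 * H - 1" and t: "t \<in> cube 0 M" for h t
  proof -
    have "mesh i dvd q h t $ j" for j
      using mesh_dvd_Suc[OF p[of j]] by (auto simp: q_def axis_def s_def m_def)
    moreover have q_a: "q h t $ a = p $ a + int h * s + m * t $ a" by (simp add: q_def axis_def)
    have "0 \<le> m * t $ a" "m * t $ a \<le> m * M" using cubeD[OF t, of a] m0 by simp_all
    then have ta: "0 \<le> m * t $ a" "m * t $ a \<le> s" by (simp_all add: sm mult.commute)
    have "0 \<le> int h * s" using s0 by simp
    then have "R \<le> q h t $ a" using ta pR(1) unfolding q_a by linarith
    moreover have "q h t $ a + side i \<le> R + side n"
    proof -
      have "int h + 2 \<le> N" using h NH by linarith
      then have "(int h + 2) * s \<le> N * s" using s0 by (intro mult_right_mono) auto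
      then have "p $ a + int h * s + s + s \<le> R + side n"
        using pN unfolding distrib_right by linarith
      then show ?thesis using ta q_a by (simp add: s_def)
    qed
    ultimately have "\<not> (1 + k) * A * of_int (side i)
        \<le> norm (f (latt (q h t + axis a (side i))) - f (latt (q h t)))" using neg by blast
    then show ?thesis by (simp add: \<rho>_def W_def F_def s_def)
  qed
  \<comment> \<open>The first summand bounds the excess of \<open>N * \<rho>\<close> over the length of \<open>V\<close>, the second one the
    displacement of the ends of a translated chain from the ends of the long segment.\<close>
  define D where "D = (k * L * of_int N + L * (2 * d + 1)) * of_int s"
  have W_sum: "(2 * real H - 1) * \<rho> - D \<le> (\<Sum>h<2 * H - 1. W h t) \<bullet> u" if t: "t \<in> cube 0 M" for t
  proof -
    define K where "K = 2 * H - 1"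
    have "(\<Sum>h<K. W h t) = (\<Sum>h<K. F (q (Suc h) t) - F (q h t))" by (simp add: W_def q_Suc)
    also have "\<dots> = F (q K t) - F (q 0 t)" by (rule sum_lessThan_telescope)
    finally have tel: "(\<Sum>h<K. W h t) = F (q K t) - F (q 0 t)" .
    have K: "int K = N - 1" using NH H0 by (simp add: K_def of_nat_diff)
    have 1: "norm (F (q 0 t) - F p) \<le> L * (d * of_int s)"
    proof -
      have "norm (F (q 0 t) - F p) \<le> L * norm (latt (q 0 t - p))" by (rule Flip) (use evq pa in auto)
      also have "q 0 t - p = m *s t" by (simp add: q_def vec_eq_iff axis_def)
      finally show ?thesis using tm[OF t] L1 by (smt (verit) mult_left_mono)
    qed
    have 2: "norm (F (q K t) - F (p + axis a l)) \<le> L * (d * of_int s + of_int s)"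
    proof -
      have "norm (F (q K t) - F (p + axis a l)) \<le> L * norm (latt (q K t - (p + axis a l)))"
        by (rule Flip) (use evq pa evs ls in \<open>auto simp: axis_def\<close>)
      also have "q K t - (p + axis a l) = m *s t - axis a s"
        by (simp add: q_def K ls vec_eq_iff axis_def algebra_simps)
      also have "norm (latt (m *s t - axis a s)) \<le> norm (latt (m *s t)) + norm (latt (axis a s) :: real ^ 'n)"
        unfolding latt_diff by (rule norm_triangle_ineq4)
      also have "\<dots> \<le> d * of_int s + of_int s" using tm[OF t] nax s0 by simp
      finally show ?thesis using L1 by (smt (verit) mult_left_mono)
    qed
    have "norm (V - (\<Sum>h<K. W h t)) \<le> norm (F (q 0 t) - F p) + norm (F (q K t) - F (p + axis a l))"
      using norm_triangle_ineq4[of "F (q 0 t) - F p" "F (q K t) - F (p + axis a l)"]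
      by (simp add: tel V_def algebra_simps)
    then have 3: "norm (V - (\<Sum>h<K. W h t)) \<le> L * (2 * d + 1) * of_int s" using 1 2 by (simp add: algebra_simps)
    have "(V - (\<Sum>h<K. W h t)) \<bullet> u \<le> norm (V - (\<Sum>h<K. W h t))"
      using norm_cauchy_schwarz[of "V - (\<Sum>h<K. W h t)" u] u1 by simp
    then have 4: "A * of_int l - L * (2 * d + 1) * of_int s \<le> (\<Sum>h<K. W h t) \<bullet> u"
      using 3 Vu Vl by (simp add: inner_diff_left)
    have "(2 * real H - 1) * \<rho> \<le> of_int N * \<rho>"
      using NH A0 k s0 by (intro mult_right_mono) (auto simp: \<rho>_def)
    also have "\<dots> = A * of_int l + k * A * of_int N * of_int s" by (simp add: \<rho>_def ls algebra_simps)
    also have "\<dots> \<le> A * of_int l + k * L * of_int N * of_int s"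
      using AL k N0 s0 by (intro add_left_mono mult_right_mono mult_left_mono) auto
    finally show ?thesis using 4 unfolding K_def[symmetric] by (simp add: D_def algebra_simps)
  qed
  have cardT: "real (card (cube 0 M :: (int ^ 'n) set)) = of_int M ^ CARD('n)"
    by (rule card_cube[OF less_imp_le[OF M0]])
  have "real (card (cube 0 M :: (int ^ 'n) set)) * D
     = (of_int M ^ CARD('n) * (k * L * of_int N + L * (2 * real CARD('n) + 1))) * of_int s"
    unfolding cardT D_def d_def by simp
  also have "\<dots> < (of_int N / 2 * \<delta>) * of_int s" using pigeonhole s0 by (intro mult_strict_right_mono) auto
  also have "\<dots> = real H * (\<delta> * of_int s)" by (simp add: NH)
  finally have D: "real (card (cube 0 M :: (int ^ 'n) set)) * D < real H * (\<delta> * of_int s)" .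
  have "\<exists>h<H. \<forall>t\<in>cube 0 M. \<rho> - \<delta> * of_int s \<le> W (2 * h) t \<bullet> u"
  proof (rule common_straight_step[OF finite_cube u1 H0 _ _ D])
    show "norm (W j t) \<le> \<rho>" if "j < 2 * H - 1" "t \<in> cube 0 M" for j t using W_le[OF that] .
    show "(2 * real H - 1) * \<rho> - D \<le> (\<Sum>h<2 * H - 1. W h t) \<bullet> u" if "t \<in> cube 0 M" for t
      using W_sum[OF that] .
  qed
  then obtain h where h: "h < H" and Wu: "\<And>t. t \<in> cube 0 M \<Longrightarrow> \<rho> - \<delta> * of_int s \<le> W (2 * h) t \<bullet> u"
    by blast
  have Wv: "norm (W (2 * h) t - \<rho> *\<^sub>R u) \<le> \<epsilon> * of_int s" if t: "t \<in> cube 0 M" for t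
  proof -
    have "(norm (W (2 * h) t - \<rho> *\<^sub>R u))\<^sup>2 \<le> 2 * \<rho> * (\<delta> * of_int s)"
      using norm_diff_direction[OF u1 W_le[OF _ t] Wu[OF t]] h by simp
    also have "\<dots> \<le> 2 * (2 * L * of_int s) * (\<delta> * of_int s)"
    proof -
      have "0 < of_int M ^ CARD('n) * (k * L * of_int N + L * (2 * real CARD('n) + 1))"
        using M0 N0 L1 k by (intro mult_pos_pos add_pos_pos) auto
      then have "0 < of_int N / 2 * \<delta>" using pigeonhole by linarith
      then have "0 < \<delta>" using N0 by (simp add: zero_less_mult_iff)
      moreover have "(1 + k) * A \<le> 2 * L" using k AL A0 by (intro mult_mono) auto
      then have "\<rho> \<le> 2 * L * of_int s" using s0 by (simp add: \<rho>_def)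
      ultimately show ?thesis using s0 by (intro mult_right_mono mult_left_mono) auto
    qed
    also have "\<dots> = (4 * L * \<delta>) * (of_int s)\<^sup>2" by (simp add: power2_eq_square)
    also have "\<dots> \<le> \<epsilon>\<^sup>2 * (of_int s)\<^sup>2" using delta by (intro mult_right_mono) auto
    finally have "(norm (W (2 * h) t - \<rho> *\<^sub>R u))\<^sup>2 \<le> (\<epsilon> * of_int s)\<^sup>2" by (simp add: power_mult_distrib)
    then show ?thesis by (rule power2_le_imp_le) (use eps(1) s0 in simp)
  qed
  \<comment> \<open>The corner of the dense cube found by the pigeonhole principle.\<close>
  define c where "c = p + axis a (2 * int h * s)"
  have ca: "c $ a = p $ a + 2 * int h * s" and cb: "c $ b = p $ b"
    using ab by (simp_all add: c_def axis_def)
  have ds: "2 * s dvd p $ a" using dvd_trans[OF double_side_dvd p] by (simp add: s_def)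
  then obtain e where e: "p $ a = 2 * s * e" by blast
  have ce: "c $ a = s * (2 * (e + int h))" by (simp add: ca e algebra_simps)
  have hN: "2 * int h + 2 \<le> N" using h NH by linarith
  have fit: "c $ a + s + s \<le> R + side n"
  proof -
    have "(2 * int h + 2) * s \<le> N * s" using hN s0 by (intro mult_right_mono) auto
    then show ?thesis using pN unfolding distrib_right ca by linarith
  qed
  have win: "y mod mesh (Suc i) < side i" if "p $ b \<le> y" "y < p $ b + side i" for y
  proof -
    have "y mod mesh (Suc i) = (y - p $ b) mod mesh (Suc i)"
      using p[of b] by (metis dvd_imp_mod_0 diff_zero mod_diff_right_eq)
    also have "\<dots> = y - p $ b" using that side_le_mesh[of i] by (intro mod_pos_pos_trivial) auto
    finally show ?thesis using that by simp
  qed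
  have "0 \<le> 2 * int h * s" using s0 by simp
  then have Rc: "R \<le> c $ a" using pR(1) unfolding ca by linarith
  have t1: "in_strip i c"
    using i mesh_dvd_Suc[OF p[of b]] Rc fit s0 ce win unfolding in_strip_def cb by (simp add: s_def)
  have t2: "in_strip i (c + axis a s)"
    using i mesh_dvd_Suc[OF p[of b]] Rc fit s0 ce win ab unfolding in_strip_def
    by (simp add: s_def axis_def cb)
  have ev: "even (c $ a div side i)" using ce s0 by (simp flip: s_def)
  have od: "odd ((c + axis a s) $ a div side i)"
  proof -
    have "(c + axis a s) $ a = s * (2 * (e + int h) + 1)" by (simp add: ce axis_def algebra_simps)
    then show ?thesis using s0 by (simp flip: s_def)
  qed
  \<comment> \<open>An integer because \<open>Q\<close> divides \<open>M\<close>.\<close>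
  define \<kappa> where "\<kappa> = s div Q"
  have "Q dvd s" using Q(2) by (simp add: sm)
  then have Qk: "of_int s = of_int Q * (of_int \<kappa> :: real)" by (simp add: \<kappa>_def flip: of_int_mult)
  have k0: "0 \<le> \<kappa>" using s0 Q by (simp add: \<kappa>_def pos_imp_zdiv_nonneg_iff)
  have "(L\<^sup>2 + 1) * real CARD('n) * of_int m + 2 * L * \<epsilon> * of_int s
     = ((L\<^sup>2 + 1) * real CARD('n) / of_int M + 2 * L * \<epsilon>) * of_int s"
    using M0 by (simp add: sm field_simps)
  also have "\<dots> \<le> (1 / of_int Q) * of_int s" using eps s0 by (intro mult_right_mono) auto
  also have "\<dots> = of_int \<kappa>" using Qk Q by simp
  finally have kap: "(L\<^sup>2 + 1) * real CARD('n) * of_int (mesh i) + 2 * L * \<epsilon> * of_int (side i) \<le> of_int \<kappa>"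
    by (simp add: m_def s_def)
  have qc: "q (2 * h) t = c + mesh i *s t" for t by (simp add: q_def c_def m_def)
  let ?E = "cube (c + axis a (side i) - (\<chi> j. \<kappa>)) (side i + 2 * \<kappa>)"
  have "card (heavy i c) \<le> card (points_over ?E)"
  proof (rule transport[OF t1 ev _ _ kap])
    show "mesh i dvd c $ a" using mesh_dvd_Suc[OF p[of a]] by (simp add: ca s_def)
    show "norm (f (latt (c + mesh i *s t + axis a (side i))) - f (latt (c + mesh i *s t)) - \<rho> *\<^sub>R u)
        \<le> \<epsilon> * of_int (side i)" if "t \<in> cube 0 M" for t
      using Wv[OF that] by (simp add: W_def F_def qc s_def)
  qed
  moreover have "13 / 10 * of_int s ^ CARD('n) \<le> real (card (heavy i c))"
    using card_heavy[OF t1] by (simp add: s_def)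
  moreover have "real (card (points_over ?E)) \<le> 9 / 10 * of_int s ^ CARD('n)"
  proof -
    have sub: "cube (c + axis a s) (side i) \<subseteq> ?E"
    proof
      fix z assume z: "z \<in> cube (c + axis a s) (side i)"
      have "(c + axis a s) $ j - \<kappa> \<le> z $ j \<and> z $ j < (c + axis a s) $ j - \<kappa> + (s + 2 * \<kappa>)" for j
        using cubeD[OF z, of j] k0 unfolding s_def by linarith
      then show "z \<in> ?E" by (simp add: cube_def s_def)
    qed
    have "real (card ?E) = (of_int s + 2 * of_int \<kappa>) ^ CARD('n)"
      using card_cube[of "side i + 2 * \<kappa>"] k0 s0 by (simp add: s_def)
    also have "of_int s + 2 * of_int \<kappa> = of_int s * (1 + 2 / of_int Q :: real)"
      using Q Qk by (simp add: field_simps)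
    also have "(\<dots>) ^ CARD('n) = (1 + 2 / of_int Q) ^ CARD('n) * of_int s ^ CARD('n)"
      by (simp add: power_mult_distrib)
    also have "\<dots> \<le> 11 / 10 * of_int s ^ CARD('n)" using Q(3) s0 by (intro mult_right_mono) auto
    finally show ?thesis using card_light[OF t2 od finite_cube sub] by (simp add: s_def)
  qed
  ultimately have "13 / 10 * of_int s ^ CARD('n) \<le> 9 / 10 * (of_int s ^ CARD('n) :: real)" by linarith
  moreover have "0 < (of_int s ^ CARD('n) :: real)" using s0 by simp
  ultimately show False by simp
qed

text \<open>
  The stretching factor is at least \<open>1 / L\<close> for the segment across the whole slab, and grows by
  \<open>1 + k\<close> on each of the \<open>n\<close> scales; in the end it exceeds \<open>L\<close>.
\<close>

lemma no_such_bijection: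
  assumes R: "side n dvd R" and long: "L\<^sup>2 < (1 + k) ^ n"
  shows False
proof -
  have "\<exists>p. (\<forall>i. mesh (n - j) dvd p $ i) \<and> R \<le> p $ a \<and> p $ a + side (n - j) \<le> R + side n \<and>
    (1 + k) ^ j / L * of_int (side (n - j)) \<le> norm (f (latt (p + axis a (side (n - j)))) - f (latt p))"
    if "j \<le> n" for j
    using that
  proof (induction j)
    case 0
    have md: "mesh n dvd R" using R by (rule dvd_trans[rotated]) simp
    let ?p = "axis a R :: int ^ 'n"
    have ev: "even R" using even_of_mesh_dvd[OF md] .
    have "norm (latt (?p + axis a (side n)) - latt ?p) \<le> L * norm (f (latt (?p + axis a (side n))) - f (latt ?p))"
      by (rule colip) (use ev even_latt in \<open>auto simp: axis_def\<close>)
    moreover have "norm (latt (?p + axis a (side n)) - latt ?p) = of_int (side n)"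
      using side_pos[of n] M0 N0 by (simp add: latt_add latt_axis norm_axis_real)
    ultimately have "of_int (side n) \<le> L * norm (f (latt (?p + axis a (side n))) - f (latt ?p))" by simp
    then have "(1 + k) ^ 0 / L * of_int (side n) \<le> norm (f (latt (?p + axis a (side n))) - f (latt ?p))"
      using L1 by (simp add: field_simps)
    moreover have "\<forall>i. mesh n dvd ?p $ i" using md by (simp add: axis_def)
    ultimately show ?case by (intro exI[of _ ?p]) (simp add: axis_def)
  next
    case (Suc j)
    then obtain p where p: "\<forall>i. mesh (n - j) dvd p $ i" "R \<le> p $ a" "p $ a + side (n - j) \<le> R + side n"
      "(1 + k) ^ j / L * of_int (side (n - j)) \<le> norm (f (latt (p + axis a (side (n - j)))) - f (latt p))"
      by auto
    have S: "n - j = Suc (n - Suc j)" using Suc.prems by simp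
    have "\<exists>q. (\<forall>i. mesh (n - Suc j) dvd q $ i) \<and> R \<le> q $ a \<and> q $ a + side (n - Suc j) \<le> R + side n \<and>
      (1 + k) * ((1 + k) ^ j / L) * of_int (side (n - Suc j))
         \<le> norm (f (latt (q + axis a (side (n - Suc j)))) - f (latt q))"
      by (rule stretch_step[of _ p]) (use p k L1 Suc.prems in \<open>auto simp: S\<close>)
    then show ?case by simp
  qed
  from this[of n] obtain p where p: "\<forall>i. mesh 0 dvd p $ i"
    "(1 + k) ^ n / L * of_int (side 0) \<le> norm (f (latt (p + axis a (side 0))) - f (latt p))"
    by auto
  have ev: "even (p $ a)" using p(1) even_of_mesh_dvd by blast
  have "norm (f (latt (p + axis a (side 0))) - f (latt p)) \<le> L * norm (latt (p + axis a (side 0)) - latt p)"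
    by (rule lip) (use ev even_latt in \<open>auto simp: axis_def\<close>)
  also have "\<dots> = L * of_int (side 0)" using M0 by (simp add: latt_add latt_axis norm_axis_real)
  finally have "(1 + k) ^ n / L * of_int (side 0) \<le> L * of_int (side 0)" using p(2) by linarith
  then have "(1 + k) ^ n / L \<le> L" by (rule mult_right_le_imp_le) (use M0 in simp)
  then show False using long L1 by (simp add: field_simps power2_eq_square)
qed

end

section \<open>The choice of constants\<close>

text \<open>
  Each constant only depends on the earlier ones, and \<open>k\<close> does not depend on \<open>N\<close>: the number \<open>n\<close> of
  scales can be fixed before the ratio \<open>N\<close> of consecutive scales is made large.
\<close>

lemma step_constants_exist:
  fixes L :: real and d :: nat
  assumes L1: "1 \<le> L"
  shows "\<exists>(Q::int) (M::int) (N::int) (n::nat) (\<epsilon>::real) \<delta> k.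
    0 < M \<and> 0 < N \<and> 2 * M dvd N \<and> 10 * int n * M \<le> N \<and>
    0 < Q \<and> Q dvd M \<and> (1 + 2 / of_int Q) ^ d \<le> (11 / 10 :: real) \<and>
    0 < \<epsilon> \<and> (L\<^sup>2 + 1) * real d / of_int M + 2 * L * \<epsilon> \<le> 1 / of_int Q \<and>
    4 * L * \<delta> \<le> \<epsilon>\<^sup>2 \<and> 0 < k \<and> k \<le> 1 \<and>
    of_int M ^ d * (k * L * of_int N + L * (2 * real d + 1)) < of_int N / 2 * \<delta> \<and>
    L\<^sup>2 < (1 + k) ^ n"
proof -
  \<comment> \<open>By \<open>1 + x \<le> exp x\<close>, the enlarged cube has at most \<open>exp (1/20) \<le> 20/19\<close> times the volume.\<close>
  define Q :: int where "Q = 40 * (int d + 1)"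
  have Q0: "0 < Q" by (simp add: Q_def)
  have "(1 + 2 / of_int Q) ^ d \<le> exp (2 / of_int Q :: real) ^ d"
    by (rule power_mono[OF exp_ge_add_one_self]) (use Q0 in auto)
  also have "\<dots> = exp (real d * (2 / of_int Q))" by (rule exp_of_nat_mult [symmetric])
  also have "\<dots> \<le> exp (1 / 20)" by (simp add: Q_def field_simps)
  also have "\<dots> \<le> (11 / 10 :: real)"
  proof -
    have "1 - 1 / 20 \<le> exp (- (1 / 20) :: real)" using exp_ge_add_one_self[of "- (1 / 20) :: real"] by simp
    then show ?thesis by (simp add: exp_minus field_simps)
  qed
  finally have Q: "(1 + 2 / of_int Q) ^ d \<le> (11 / 10 :: real)" .
  define \<epsilon> where "\<epsilon> = 1 / (4 * L * of_int Q)"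
  have e0: "0 < \<epsilon>" using L1 Q0 by (simp add: \<epsilon>_def)
  have Lq: "1 \<le> L * real_of_int Q" using L1 Q0 mult_mono[of 1 L 1 "real_of_int Q"] by simp
  then have e1: "\<epsilon> \<le> 1" by (simp add: \<epsilon>_def)
  define M0 where "M0 = \<lceil>2 * (L\<^sup>2 + 1) * real d\<rceil> + 1"
  define M where "M = Q * M0"
  have M0: "2 * (L\<^sup>2 + 1) * real d \<le> of_int M0" "0 < M0"
  proof -
    show "2 * (L\<^sup>2 + 1) * real d \<le> of_int M0" unfolding M0_def by linarith
    have "0 \<le> 2 * (L\<^sup>2 + 1) * real d" by simp
    then show "0 < M0" unfolding M0_def by linarith
  qed
  have Mp: "0 < M" using M0 Q0 by (simp add: M_def)
  have "(L\<^sup>2 + 1) * real d / of_int M0 \<le> 1 / 2" using M0 by (simp add: field_simps)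
  then have "(L\<^sup>2 + 1) * real d / of_int M0 / of_int Q \<le> 1 / 2 / of_int Q"
    using Q0 by (intro divide_right_mono) auto
  then have "(L\<^sup>2 + 1) * real d / of_int M \<le> 1 / (2 * of_int Q)"
    by (simp add: M_def mult.commute)
  moreover have "2 * L * \<epsilon> = 1 / (2 * of_int Q)" using L1 by (simp add: \<epsilon>_def)
  ultimately have eps: "(L\<^sup>2 + 1) * real d / of_int M + 2 * L * \<epsilon> \<le> 1 / of_int Q" by simp
  define \<delta> where "\<delta> = \<epsilon>\<^sup>2 / (4 * L)"
  have d0: "0 < \<delta>" using e0 L1 by (simp add: \<delta>_def)
  have "\<epsilon>\<^sup>2 \<le> 1" using e0 e1 by (simp add: power_le_one)
  then have d1: "\<delta> \<le> 1" using L1 by (simp add: \<delta>_def)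
  have del: "4 * L * \<delta> \<le> \<epsilon>\<^sup>2" using L1 by (simp add: \<delta>_def)
  define P where "P = (of_int M :: real) ^ d"
  have P1: "1 \<le> P" using Mp by (simp add: P_def one_le_power)
  define k where "k = \<delta> / (8 * L * P)"
  have k0: "0 < k" using d0 L1 P1 by (simp add: k_def)
  have "1 \<le> L * P" using L1 P1 mult_mono[of 1 L 1 P] by simp
  then have k1: "k \<le> 1" using d1 by (simp add: k_def)
  obtain n where n: "L\<^sup>2 < (1 + k) ^ n" using real_arch_pow[of "1 + k" "L\<^sup>2"] k0 by auto
  \<comment> \<open>For \<open>N \<ge> x\<close> the second summand of the pigeonhole condition is at most \<open>N * \<delta> / 8\<close>, as is the
    first one by the choice of \<open>k\<close>.\<close>
  define x where "x = 8 * P * L * (2 * real d + 1) / \<delta>"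
  have x0: "0 \<le> x" using P1 L1 d0 by (simp add: x_def)
  define w where "w = 5 * int n + 1 + \<lceil>x\<rceil>"
  have w0: "0 < w" "5 * int n \<le> w" "x \<le> of_int w" using x0 unfolding w_def by linarith+
  define N where "N = 2 * M * w"
  have N0: "0 < N" using Mp w0 by (simp add: N_def)
  have wN: "w \<le> N" using Mp w0 by (simp add: N_def)
  have sparse: "10 * int n * M \<le> N" using mult_left_mono[OF w0(2), of "2 * M"] Mp by (simp add: N_def algebra_simps)
  have xN: "x \<le> of_int N" using w0(3) wN by linarith
  have "P * (k * L * of_int N) = of_int N * \<delta> / 8" using L1 P1 by (simp add: k_def)
  moreover have "P * (L * (2 * real d + 1)) \<le> of_int N * \<delta> / 8"
    using xN d0 by (simp add: x_def field_simps)
  moreover have "0 < of_int N * \<delta>" using N0 d0 by simp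
  ultimately have pig: "P * (k * L * of_int N + L * (2 * real d + 1)) < of_int N / 2 * \<delta>"
    unfolding distrib_left[of P] by linarith
  show ?thesis
    using Mp N0 sparse Q0 Q e0 eps del k0 k1 pig n
    by (intro exI[of _ Q] exI[of _ M] exI[of _ N] exI[of _ n] exI[of _ \<epsilon>] exI[of _ \<delta>] exI[of _ k])
       (simp add: P_def M_def N_def)
qed

text \<open>
  The constants depend only on the Lipschitz constant and the dimension, not on the position \<open>R\<close> of the
  slab, on the set outside of the slab, or on the bijection.
\<close>

lemma checkered_not_bilipschitz:
  fixes L :: real
  assumes L1: "1 \<le> L"
  shows "\<exists>M N n. 0 < M \<and> 0 < N \<and> 2 * M dvd N \<and>
    \<not> (\<exists>(a :: 'n :: finite) b R X (f :: real ^ 'n \<Rightarrow> real ^ 'n). a \<noteq> b \<and> 2 * M * N ^ n dvd R \<and> checkered a b M N n R X \<and>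
       bij_betw f X (range latt) \<and>
       (\<forall>x\<in>X. \<forall>y\<in>X. norm (f x - f y) \<le> L * norm (x - y) \<and> norm (x - y) \<le> L * norm (f x - f y)))"
proof -
  obtain Q M N :: int and n :: nat and \<epsilon> \<delta> k :: real where c:
    "0 < M" "0 < N" "2 * M dvd N" "10 * int n * M \<le> N"
    "0 < Q" "Q dvd M" "(1 + 2 / of_int Q) ^ CARD('n) \<le> (11 / 10 :: real)"
    "0 < \<epsilon>" "(L\<^sup>2 + 1) * real CARD('n) / of_int M + 2 * L * \<epsilon> \<le> 1 / of_int Q"
    "4 * L * \<delta> \<le> \<epsilon>\<^sup>2" "0 < k" "k \<le> 1"
    "of_int M ^ CARD('n) * (k * L * of_int N + L * (2 * real CARD('n) + 1)) < of_int N / 2 * \<delta>"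
    "L\<^sup>2 < (1 + k) ^ n"
    using step_constants_exist[OF L1, of "CARD('n)"] by blast
  have False
    if "a \<noteq> b" "2 * M * N ^ n dvd R" "checkered a b M N n R X" "bij_betw f X (range latt)"
      "\<forall>x\<in>X. \<forall>y\<in>X. norm (f x - f y) \<le> L * norm (x - y) \<and> norm (x - y) \<le> L * norm (f x - f y)"
    for a b :: 'n and R X and f :: "real ^ 'n \<Rightarrow> real ^ 'n"
  proof -
    interpret checkered_step a b M N n R X f L Q \<epsilon> \<delta> k
      by unfold_locales (use c that L1 in auto)
    show False using no_such_bijection that(2) c by blast
  qed
  then show ?thesis using c by blast
qed

section \<open>A checkered net at small displacement from the lattice\<close>

text \<open>
  Slab \<open>K\<close> occupies \<open>R K \<le> x < R K + 2 * M K * N K ^ n K\<close> in direction \<open>a\<close> and carries a pattern with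
  its own constants. The divisibility conditions make its end points multiples of twice the side of
  every cube, so that the dense and sparse cubes of each scale come in pairs inside the slab.
\<close>

locale slabs =
  fixes M N :: "nat \<Rightarrow> int" and n :: "nat \<Rightarrow> nat" and R :: "nat \<Rightarrow> int"
  assumes M0: "0 < M K" and N0: "0 < N K" and MN: "2 * M K dvd N K"
    and R_dvd: "2 * M K * N K ^ n K dvd R K"
    and R_Suc: "R K + 2 * M K * N K ^ n K \<le> R (Suc K)"
begin

definition in_slab :: "nat \<Rightarrow> int \<Rightarrow> bool" where
  "in_slab K x \<longleftrightarrow> R K \<le> x \<and> x < R K + 2 * M K * N K ^ n K"

definition cell_side :: "nat \<Rightarrow> nat \<Rightarrow> int" where
  "cell_side K i = 2 * M K * N K ^ i"

text \<open>
  In each sparse cube half of the lattice points, those with odd coordinate, are moved by one cube to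
  the dense cube before it.
\<close>

definition shifts :: "int \<Rightarrow> int \<Rightarrow> int \<Rightarrow> bool" where
  "shifts x y s \<longleftrightarrow> (\<exists>K i. i < n K \<and> in_slab K x \<and> active (M K) (N K) i y \<and>
     s = cell_side K i \<and> odd x \<and> odd (x div s))"

text \<open>
  At most one shift is possible for each point (\<open>shifts_functional\<close>), so the choice operator only picks
  this value.
\<close>

definition displace :: "'n \<Rightarrow> 'n \<Rightarrow> int ^ 'n \<Rightarrow> real ^ 'n" where
  "displace a b z =
    (if \<exists>s. shifts (z $ a) (z $ b) s
     then halfway a (z - axis a (SOME s. shifts (z $ a) (z $ b) s)) else latt z)"

lemma cell_side_pos: "0 < cell_side K i"
  using M0 N0 by (simp add: cell_side_def)

lemma even_cell_side: "even (cell_side K i)"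
  by (simp add: cell_side_def)

lemma R_mono: "K < K' \<Longrightarrow> R K + 2 * M K * N K ^ n K \<le> R K'"
proof (induction K' rule: less_Suc_induct)
  case (1 i) then show ?case by (rule R_Suc)
next
  case (2 i j k)
  moreover have "0 < 2 * M j * N j ^ n j" using M0 N0 by simp
  ultimately show ?case by linarith
qed

lemma in_slab_unique: "in_slab K x \<Longrightarrow> in_slab K' x \<Longrightarrow> K = K'"
  using R_mono[of K K'] R_mono[of K' K] by (cases K K' rule: linorder_cases) (auto simp: in_slab_def)

lemma active_unique: "active m l i y \<Longrightarrow> active m l j y \<Longrightarrow> i = j"
  by (cases i j rule: linorder_cases) (auto simp: active_def fine_window_def)

lemma slab_blocks:
  assumes "i < n K"
  obtains e e' where "R K = 2 * cell_side K i * e" "R K + 2 * M K * N K ^ n K = 2 * cell_side K i * e'"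
proof -
  define j where "j = n K - Suc i"
  have nK: "n K = Suc (i + j)" using assms by (simp add: j_def)
  have "2 * cell_side K i = (2 * M K) * (2 * N K ^ i)" by (simp add: cell_side_def)
  also have "\<dots> dvd N K * (2 * N K ^ i)" by (rule mult_dvd_mono[OF MN dvd_refl])
  also have "\<dots> dvd 2 * M K * N K ^ n K" by (simp add: nK power_add)
  finally have d: "2 * cell_side K i dvd 2 * M K * N K ^ n K" .
  have "2 * cell_side K i dvd R K" using d R_dvd by (rule dvd_trans)
  moreover from this have "2 * cell_side K i dvd R K + 2 * M K * N K ^ n K" using d by (rule dvd_add)
  ultimately show ?thesis using that by blast
qed

lemma in_slab_left:
  assumes i: "i < n K" and x: "in_slab K x" and o: "odd (x div cell_side K i)"
  shows "in_slab K (x - cell_side K i)"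
proof -
  let ?s = "cell_side K i"
  obtain e where e: "R K = 2 * ?s * e" using slab_blocks[OF i] by metis
  have s: "0 < ?s" by (rule cell_side_pos)
  define q where "q = x div ?s"
  have "R K div ?s \<le> q" unfolding q_def using x s by (intro zdiv_mono1) (auto simp: in_slab_def)
  then have "2 * e \<le> q" using s by (simp add: e)
  moreover have "odd q" using o by (simp add: q_def)
  ultimately have "2 * e + 1 \<le> q" by presburger
  then have "(2 * e + 1) * ?s \<le> q * ?s" using s by (intro mult_right_mono) auto
  also have "\<dots> \<le> x" using div_mult_mod_eq[of x ?s] pos_mod_sign[OF s, of x] unfolding q_def by linarith
  finally show ?thesis using x s by (simp add: in_slab_def e algebra_simps)
qed

lemma in_slab_right:
  assumes i: "i < n K" and x: "in_slab K x" and o: "even (x div cell_side K i)"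
  shows "in_slab K (x + cell_side K i)"
proof -
  let ?s = "cell_side K i"
  obtain e where e: "R K + 2 * M K * N K ^ n K = 2 * ?s * e" using slab_blocks[OF i] by metis
  have s: "0 < ?s" by (rule cell_side_pos)
  define q where "q = x div ?s"
  have xl: "q * ?s + x mod ?s = x" "x mod ?s < ?s" "0 \<le> x mod ?s" using s by (auto simp: q_def)
  have "x < 2 * e * ?s" using x e by (simp add: in_slab_def mult_ac)
  then have "q * ?s < 2 * e * ?s" using xl by linarith
  then have "q < 2 * e" using s by simp
  moreover have "even q" using o by (simp add: q_def)
  ultimately have "q + 2 \<le> 2 * e" by presburger
  then have "(q + 2) * ?s \<le> 2 * e * ?s" using s by (intro mult_right_mono) auto
  then have "x + ?s < 2 * e * ?s" using xl unfolding distrib_right by linarith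
  then have "x + ?s < 2 * ?s * e" by (simp add: mult_ac)
  then show ?thesis using x s e by (simp add: in_slab_def)
qed

text \<open>
  A shift stays inside its slab, and it depends only on the slab and on the \<open>b\<close>-coordinate. So it can
  be recovered from the position after the shift; this makes \<open>displace\<close> injective.
\<close>

lemma shifts_unique:
  assumes "shifts x y s" "shifts x' y s'" "x - s = x' - s'"
  shows "s = s'"
proof -
  obtain K i where 1: "i < n K" "in_slab K x" "active (M K) (N K) i y" "s = cell_side K i" "odd (x div s)"
    using assms(1) by (auto simp: shifts_def)
  obtain K' i' where 2: "i' < n K'" "in_slab K' x'" "active (M K') (N K') i' y" "s' = cell_side K' i'" "odd (x' div s')"
    using assms(2) by (auto simp: shifts_def)
  have "in_slab K (x - s)" using in_slab_left[OF 1(1,2)] 1(4,5) by simp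
  moreover have "in_slab K' (x - s)" unfolding assms(3) using in_slab_left[OF 2(1,2)] 2(4,5) by simp
  ultimately have K: "K = K'" by (rule in_slab_unique)
  have "i = i'" using active_unique[OF 1(3)] 2(3) K by simp
  then show ?thesis using 1(4) 2(4) K by simp
qed

lemma shifts_in_cell:
  assumes "shifts x y s" "in_slab K x" "active (M K) (N K) i y"
  shows "s = cell_side K i" "odd (x div cell_side K i)"
proof -
  obtain K' i' where 1: "in_slab K' x" "active (M K') (N K') i' y" "s = cell_side K' i'" "odd (x div s)"
    using assms(1) by (auto simp: shifts_def)
  have K: "K' = K" using in_slab_unique 1(1) assms(2) .
  have "i' = i" using active_unique[OF 1(2)] assms(3) K by simp
  then show "s = cell_side K i" "odd (x div cell_side K i)" using 1 K by simp_all
qed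

lemma shifts_functional:
  assumes "shifts x y s" "shifts x y s'"
  shows "s = s'"
proof -
  obtain K i where "in_slab K x" "active (M K) (N K) i y" using assms(1) by (auto simp: shifts_def)
  then show ?thesis using shifts_in_cell(1)[OF assms(1)] shifts_in_cell(1)[OF assms(2)] by simp
qed

lemma displace_cases:
  obtains (still) "\<And>s. \<not> shifts (z $ a) (z $ b) s" "displace a b z = latt z"
  | (shift) s where "shifts (z $ a) (z $ b) s" "displace a b z = halfway a (z - axis a s)"
proof (cases "\<exists>s. shifts (z $ a) (z $ b) s")
  case True
  then have "shifts (z $ a) (z $ b) (SOME s. shifts (z $ a) (z $ b) s)" by (rule someI_ex)
  then show ?thesis using True shift by (simp add: displace_def)
qed (use still in \<open>simp add: displace_def\<close>)

lemma displace_shift: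
  assumes "shifts (z $ a) (z $ b) s"
  shows "displace a b z = halfway a (z - axis a s)"
proof (cases rule: displace_cases[of z a b])
  case (shift s')
  then show ?thesis using shifts_functional[OF assms shift(1)] by simp
qed (use assms in auto)

lemma inj_displace:
  assumes "a \<noteq> b"
  shows "inj (displace a b)"
proof (rule injI)
  fix z z' assume eq: "displace a b z = displace a b z'"
  show "z = z'"
  proof (cases rule: displace_cases[of z a b])
    case still
    show ?thesis
      by (cases rule: displace_cases[of z' a b])
         (use eq still latt_neq_halfway latt_neq_halfway[THEN not_sym] in \<open>auto dest: injD[OF inj_latt]\<close>)
  next
    case (shift s)
    show ?thesis
    proof (cases rule: displace_cases[of z' a b])
      case still
      then show ?thesis using eq shift latt_neq_halfway by metis
    next
      case (shift s')
      then have d: "z - axis a s = z' - axis a s'"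
        using eq \<open>displace a b z = halfway a (z - axis a s)\<close> inj_halfway[of a] by (metis injD)
      have "(z - axis a s) $ a = (z' - axis a s') $ a" "(z - axis a s) $ b = (z' - axis a s') $ b"
        using d by simp_all
      then have "z $ a - s = z' $ a - s'" "z $ b = z' $ b" using assms by (simp_all add: axis_def)
      then have "s = s'" using \<open>shifts (z $ a) (z $ b) s\<close> shift(1) shifts_unique by metis
      then show ?thesis using d by simp
    qed
  qed
qed

lemma displace_even: "even (z $ a) \<Longrightarrow> displace a b z = latt z"
  by (cases rule: displace_cases[of z a b]) (auto simp: shifts_def)

lemma displace_form: "range (displace a b) \<subseteq> range latt \<union> range (halfway a)"
proof
  fix x assume "x \<in> range (displace a b)"
  then obtain z where "x = displace a b z" by blast
  then show "x \<in> range latt \<union> range (halfway a)" by (cases rule: displace_cases[of z a b]) auto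
qed

text \<open>
  The half-integer points of a dense cube are the images of the odd points of the sparse cube after
  it; no image falls into a sparse cube, since its preimage would lie in the dense cube that follows.
\<close>

lemma checkered_displace:
  fixes a b :: "'n :: finite"
  assumes ab: "a \<noteq> b"
  shows "checkered a b (M K) (N K) (n K) (R K) (range (displace a b))"
  unfolding checkered_def
proof (intro conjI allI impI displace_form)
  show "latt z \<in> range (displace a b)" if "even (z $ a)" for z
    using displace_even[OF that] by (metis rangeI)
  fix z :: "int ^ 'n" and i
  assume i: "i < n K" and z: "R K \<le> z $ a \<and> z $ a < R K + 2 * M K * N K ^ n K \<and> active (M K) (N K) i (z $ b)"
  let ?s = "cell_side K i"
  have s: "0 < ?s" by (rule cell_side_pos)
  have slab: "in_slab K (z $ a)" and act: "active (M K) (N K) i (z $ b)" using z by (auto simp: in_slab_def)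
  have "if even (z $ a div ?s)
        then latt z \<in> range (displace a b) \<and> (odd (z $ a) \<longrightarrow> halfway a z \<in> range (displace a b))
        else halfway a z \<notin> range (displace a b) \<and> (odd (z $ a) \<longrightarrow> latt z \<notin> range (displace a b))"
  proof (cases "even (z $ a div ?s)")
    case True
    have "displace a b z = latt z"
    proof (cases rule: displace_cases[of z a b])
      case (shift s')
      then show ?thesis using shifts_in_cell(2)[OF shift(1) slab act] True by simp
    qed
    then have 1: "latt z \<in> range (displace a b)" by (metis rangeI)
    have "halfway a z \<in> range (displace a b)" if "odd (z $ a)"
    proof -
      let ?z = "z + axis a ?s"
      have "in_slab K (z $ a + ?s)" using in_slab_right[OF i slab True] .
      moreover have "odd (z $ a + ?s)" using that even_cell_side[of K i] by simp
      moreover have "odd ((z $ a + ?s) div ?s)" using True s by simp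
      ultimately have "shifts (?z $ a) (?z $ b) ?s"
        using i act ab unfolding shifts_def by (intro exI[of _ K] exI[of _ i]) (simp add: axis_def)
      then have "displace a b ?z = halfway a z" by (simp add: displace_shift)
      then show ?thesis by (metis rangeI)
    qed
    with 1 True show ?thesis by simp
  next
    case False
    have "halfway a z \<noteq> displace a b z'" for z'
    proof (cases rule: displace_cases[of z' a b])
      case still
      then show ?thesis using latt_neq_halfway by metis
    next
      case (shift s')
      show ?thesis
      proof
        assume "halfway a z = displace a b z'"
        then have z': "z = z' - axis a s'" using shift(2) inj_halfway[of a] by (metis injD)
        then have za: "z $ a = z' $ a - s'" and zb: "z $ b = z' $ b" using ab by (simp_all add: axis_def)
        obtain K' i' where 2: "i' < n K'" "in_slab K' (z' $ a)" "active (M K') (N K') i' (z' $ b)"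
          "s' = cell_side K' i'" "odd (z' $ a div s')"
          using shift(1) by (auto simp: shifts_def)
        have "in_slab K' (z $ a)" unfolding za using in_slab_left[OF 2(1,2)] 2(4,5) by simp
        then have K: "K' = K" using slab by (rule in_slab_unique)
        have "i' = i" using active_unique[OF 2(3)] act zb K by simp
        then have "s' = ?s" using 2(4) K by simp
        then have "z' $ a = z $ a + ?s" using za by simp
        then have "z' $ a div s' = z $ a div ?s + 1" using s \<open>s' = ?s\<close> by simp
        then show False using 2 False by simp
      qed
    qed
    moreover have "latt z \<noteq> displace a b z'" if "odd (z $ a)" for z'
    proof (cases rule: displace_cases[of z' a b])
      case still
      have "shifts (z $ a) (z $ b) ?s"
        using i slab act that False unfolding shifts_def by blast
      then show ?thesis using still inj_latt by (metis injD)
    next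
      case (shift s')
      then show ?thesis using latt_neq_halfway by metis
    qed
    ultimately show ?thesis using False by auto
  qed
  then show "if even (z $ a div (2 * M K * N K ^ i))
        then latt z \<in> range (displace a b) \<and> (odd (z $ a) \<longrightarrow> halfway a z \<in> range (displace a b))
        else halfway a z \<notin> range (displace a b) \<and> (odd (z $ a) \<longrightarrow> latt z \<notin> range (displace a b))"
    by (simp only: cell_side_def)
qed

text \<open>
  A moved point lies in some slab, hence at distance at least \<open>R K\<close> from the origin, and moves by less
  than the length of the slab.
\<close>

lemma norm_displace:
  fixes z :: "int ^ 'n"
  assumes big: "\<And>K t. real_of_int (R K) \<le> t \<Longrightarrow> of_int (2 * M K * N K ^ n K) \<le> \<phi> t"
    and pos: "\<And>t. t > 0 \<Longrightarrow> 0 \<le> \<phi> t" and r: "norm (latt z) \<le> r" "0 < r"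
  shows "norm (displace a b z - latt z) \<le> \<phi> r"
proof (cases rule: displace_cases[of z a b])
  case still
  then show ?thesis using pos r by simp
next
  case (shift s)
  then obtain K i where K: "i < n K" "in_slab K (z $ a)" "s = cell_side K i" by (auto simp: shifts_def)
  have s: "1 \<le> s" using cell_side_pos[of K i] K by simp
  have "displace a b z - latt z = axis a (1 / 2 - of_int s)"
    by (simp add: shift(2) halfway_def latt_diff latt_axis vec_eq_iff axis_def)
  then have "norm (displace a b z - latt z) = \<bar>1 / 2 - of_int s\<bar>" by (simp add: norm_axis_real)
  also have "\<dots> \<le> of_int s" using s by linarith
  also have "\<dots> \<le> of_int (2 * M K * N K ^ n K)"
  proof -
    have "N K ^ i \<le> N K ^ n K" using N0[of K] K(1) by (intro power_increasing) auto
    then have "s \<le> 2 * M K * N K ^ n K" unfolding K(3) cell_side_def using M0[of K] by (intro mult_left_mono) auto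
    then show ?thesis by (simp only: of_int_le_iff)
  qed
  also have "\<dots> \<le> \<phi> r"
  proof (rule big)
    have "real_of_int (R K) \<le> of_int (z $ a)" using K(2) by (simp add: in_slab_def)
    also have "\<dots> \<le> norm (latt z)" using component_le_norm_cart[of "latt z" a] by simp
    finally show "real_of_int (R K) \<le> r" using r by simp
  qed
  finally show ?thesis .
qed

end

section \<open>Unbounded gauge functions\<close>

text \<open>
  The slabs are placed one after the other, each so far out that \<open>\<phi>\<close> exceeds its length there.
\<close>

lemma slab_positions_exist:
  fixes len :: "nat \<Rightarrow> int"
  assumes len: "\<And>K. 0 < len K" and big: "\<And>B. \<exists>T. \<forall>t\<ge>T. B \<le> (\<phi> :: real \<Rightarrow> real) t"
  shows "\<exists>R. \<forall>K. len K dvd R K \<and> R K + len K \<le> R (Suc K) \<and>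
    (\<forall>t \<ge> of_int (R K). of_int (len K) \<le> \<phi> t)"
proof -
  have step: "\<exists>r. len K dvd r \<and> x \<le> r \<and> (\<forall>t \<ge> of_int r. of_int (len K) \<le> \<phi> t)" for K x
  proof -
    obtain T where T: "\<forall>t\<ge>T. of_int (len K) \<le> \<phi> t" using big by blast
    define y where "y = \<bar>x\<bar> + \<lceil>\<bar>T\<bar>\<rceil>"
    have y: "x \<le> y" "0 \<le> y" "T \<le> of_int y" unfolding y_def by linarith+
    have "y \<le> len K * y" using len[of K] y(2) mult_right_mono[of 1 "len K" y] by simp
    then have "x \<le> len K * y" "T \<le> of_int (len K * y)"
      using y by (auto intro: order_trans simp del: of_int_mult)
    then show ?thesis using T by (intro exI[of _ "len K * y"]) auto
  qed
  have "\<exists>R. \<forall>K. (len K dvd R K \<and> (\<forall>t \<ge> of_int (R K). of_int (len K) \<le> \<phi> t)) \<and> R K + len K \<le> R (Suc K)"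
  proof (rule dependent_nat_choice)
    show "\<exists>r. len 0 dvd r \<and> (\<forall>t \<ge> of_int r. of_int (len 0) \<le> \<phi> t)" using step by blast
    show "\<exists>r. (len (Suc K) dvd r \<and> (\<forall>t \<ge> of_int r. of_int (len (Suc K)) \<le> \<phi> t)) \<and> x + len K \<le> r" for x K
      using step[of "Suc K" "x + len K"] by blast
  qed
  then obtain R where R: "\<And>K. (len K dvd R K \<and> (\<forall>t \<ge> of_int (R K). of_int (len K) \<le> \<phi> t)) \<and>
    R K + len K \<le> R (Suc K)" by blast
  show ?thesis by (rule exI[of _ R], rule allI) (use R in simp)
qed

lemma unbounded_mono_eventually_large:
  fixes \<phi> :: "real \<Rightarrow> real"
  assumes pos: "\<And>t. t > 0 \<Longrightarrow> \<phi> t > 0" and mono: "mono_on {0<..} \<phi>"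
    and unb: "\<not> bounded (\<phi> ` {0<..})"
  shows "\<exists>T>0. \<forall>t\<ge>T. B \<le> \<phi> t"
proof -
  have "\<exists>T>0. B < \<phi> T"
  proof (rule ccontr)
    assume "\<not> ?thesis"
    then have "norm (\<phi> t) \<le> B" if "t > 0" for t using pos[OF that] that by force
    then have "bounded (\<phi> ` {0<..})" by (auto simp: bounded_iff)
    then show False using unb by simp
  qed
  then obtain T where T: "T > 0" "B < \<phi> T" by blast
  have "B \<le> \<phi> t" if "t \<ge> T" for t
    using mono_onD[OF mono, of T t] T that by simp
  then show ?thesis using T by blast
qed

text \<open>
  With slab \<open>K\<close> built from the constants that exclude the Lipschitz constant \<open>Suc K\<close>, every possible
  bilipschitz bijection is excluded by one of the slabs.
\<close>

lemma displaced_lattice_exists: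
  fixes \<phi> :: "real \<Rightarrow> real"
  assumes card: "CARD('n :: finite) \<ge> 2"
    and pos: "\<And>t. t > 0 \<Longrightarrow> \<phi> t > 0" and mono: "mono_on {0<..} \<phi>"
    and unb: "\<not> bounded (\<phi> ` {0<..})"
  shows "\<exists>X Y :: (real ^ 'n) set. separated_net X \<and> separated_net Y \<and>
    displacement_equivalent \<phi> X Y \<and> \<not> bilipschitz_equivalent X Y"
proof -
  obtain a b :: 'n where ab: "a \<noteq> b"
    using card by (metis card_1_singleton_iff One_nat_def card_le_Suc0_iff_eq finite UNIV_I not_less_eq_eq numeral_2_eq_2)
  have "\<exists>M N n. 0 < M \<and> 0 < N \<and> 2 * M dvd N \<and>
    \<not> (\<exists>(a :: 'n) b R X (f :: real ^ 'n \<Rightarrow> real ^ 'n). a \<noteq> b \<and> 2 * M * N ^ n dvd R \<and> checkered a b M N n R X \<and>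
       bij_betw f X (range latt) \<and>
       (\<forall>x\<in>X. \<forall>y\<in>X. norm (f x - f y) \<le> real (Suc K) * norm (x - y) \<and>
          norm (x - y) \<le> real (Suc K) * norm (f x - f y)))" for K
    by (rule checkered_not_bilipschitz) simp
  then obtain M N n where MNn: "\<And>K. 0 < M K" "\<And>K. 0 < N K" "\<And>K. 2 * M K dvd N K"
    and no: "\<And>K (a :: 'n) b R X (f :: real ^ 'n \<Rightarrow> real ^ 'n).
      a \<noteq> b \<Longrightarrow> 2 * M K * N K ^ n K dvd R \<Longrightarrow> checkered a b (M K) (N K) (n K) R X \<Longrightarrow>
      bij_betw f X (range latt) \<Longrightarrow>
      (\<And>x y. x \<in> X \<Longrightarrow> y \<in> X \<Longrightarrow> norm (f x - f y) \<le> real (Suc K) * norm (x - y)) \<Longrightarrow>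
      (\<And>x y. x \<in> X \<Longrightarrow> y \<in> X \<Longrightarrow> norm (x - y) \<le> real (Suc K) * norm (f x - f y)) \<Longrightarrow> False"
    by metis
  obtain R where R: "\<And>K. 2 * M K * N K ^ n K dvd R K"
    "\<And>K. R K + 2 * M K * N K ^ n K \<le> R (Suc K)"
    "\<And>K t. of_int (R K) \<le> t \<Longrightarrow> of_int (2 * M K * N K ^ n K) \<le> \<phi> t"
  proof -
    have "\<exists>T. \<forall>t\<ge>T. B \<le> \<phi> t" for B
      using unbounded_mono_eventually_large[OF pos mono unb] by blast
    then have "\<exists>R. \<forall>K. 2 * M K * N K ^ n K dvd R K \<and>
        R K + 2 * M K * N K ^ n K \<le> R (Suc K) \<and> (\<forall>t \<ge> of_int (R K). of_int (2 * M K * N K ^ n K) \<le> \<phi> t)"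
      by (rule slab_positions_exist[rotated]) (use MNn in simp)
    then obtain R where R: "\<And>K. 2 * M K * N K ^ n K dvd R K \<and>
        R K + 2 * M K * N K ^ n K \<le> R (Suc K) \<and> (\<forall>t \<ge> of_int (R K). of_int (2 * M K * N K ^ n K) \<le> \<phi> t)"
      by auto
    show ?thesis by (rule that[of R]) (use R in blast)+
  qed
  interpret slabs M N n R by unfold_locales (use MNn R in auto)
  let ?X = "range latt :: (real ^ 'n) set" and ?Y = "range (displace a b)"
  have chk: "checkered a b (M K) (N K) (n K) (R K) ?Y" for K by (rule checkered_displace[OF ab])
  have X: "separated_net ?X" by (rule half_integral_separated_net[of _ a]) auto
  have Y: "separated_net ?Y"
    by (rule half_integral_separated_net[OF displace_form]) (metis displace_even rangeI)
  define f where "f x = displace a b (inv latt x)" for x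
  have f: "f (latt z) = displace a b z" for z by (simp add: f_def inv_f_f[OF inj_latt])
  have "bij_betw f ?X ?Y"
    unfolding bij_betw_def
  proof
    show "inj_on f ?X" using inj_displace[OF ab] by (auto intro!: inj_onI simp: f dest: injD)
    show "f ` ?X = ?Y" by (auto simp: f image_image)
  qed
  then have "displacement_equivalent \<phi> ?X ?Y"
  proof (rule displacement_equivalentI[OF _ pos])
    fix x r assume "x \<in> ?X" and r: "norm x \<le> r" "0 < r"
    then obtain z where x: "x = latt z" by blast
    have "norm (displace a b z - latt z) \<le> \<phi> r"
    proof (rule norm_displace[where \<phi> = \<phi> and r = r])
      show "of_int (2 * M K * N K ^ n K) \<le> \<phi> t" if "real_of_int (R K) \<le> t" for K t
        using that by (rule R(3))
      show "0 \<le> \<phi> t" if "t > 0" for t using pos[OF that] by simp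
    qed (use r x in auto)
    then show "norm (f x - x) \<le> \<phi> r" by (simp add: x f)
  qed
  moreover have "\<not> bilipschitz_equivalent ?X ?Y"
  proof
    assume "bilipschitz_equivalent ?X ?Y"
    then show False
    proof (rule bilipschitz_inverse_estimates)
      fix g :: "real ^ 'n \<Rightarrow> real ^ 'n" and K :: nat
      assume g: "bij_betw g ?Y ?X"
        "\<And>x y. x \<in> ?Y \<Longrightarrow> y \<in> ?Y \<Longrightarrow> norm (g x - g y) \<le> real (Suc K) * norm (x - y)"
        "\<And>x y. x \<in> ?Y \<Longrightarrow> y \<in> ?Y \<Longrightarrow> norm (x - y) \<le> real (Suc K) * norm (g x - g y)"
      show False by (rule no[OF ab R(1) chk g])
    qed
  qed
  ultimately show ?thesis using X Y by blast
qed

section \<open>The characterisation\<close>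

theorem theorem1p9:
  fixes \<phi> :: "real \<Rightarrow> real"
  assumes "CARD('n::finite) \<ge> 2"
    and "\<And>t. t > 0 \<Longrightarrow> \<phi> t > 0"
    and "mono_on {0<..} \<phi>"
    and "concave_on {0<..} \<phi>"
  shows "(\<forall>X Y :: (real ^ 'n) set. separated_net X \<and> separated_net Y \<and>
            displacement_equivalent \<phi> X Y \<longrightarrow> bilipschitz_equivalent X Y)
         \<longleftrightarrow> bounded (\<phi> ` {0<..})"
proof
  assume "\<forall>X Y :: (real ^ 'n) set. separated_net X \<and> separated_net Y \<and>
            displacement_equivalent \<phi> X Y \<longrightarrow> bilipschitz_equivalent X Y"
  then show "bounded (\<phi> ` {0<..})"
    using displaced_lattice_exists[OF assms(1-3)] by blast
next
  assume bd: "bounded (\<phi> ` {0<..})"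
  show "\<forall>X Y :: (real ^ 'n) set. separated_net X \<and> separated_net Y \<and>
            displacement_equivalent \<phi> X Y \<longrightarrow> bilipschitz_equivalent X Y"
  proof (intro allI impI)
    fix X Y :: "(real ^ 'n) set"
    assume XY: "separated_net X \<and> separated_net Y \<and> displacement_equivalent \<phi> X Y"
    then obtain f where f: "bij_betw f X Y" "Limsup at_top (\<lambda>R. disp X f R / ereal (\<phi> R)) < \<infinity>"
      unfolding displacement_equivalent_def by blast
    obtain B where "\<forall>x\<in>X. norm (f x - x) \<le> B"
      using bounded_displacement_function[OF assms(2) bd f(2)] by blast
    then show "bilipschitz_equivalent X Y"
      using XY f(1) by (intro bounded_displacement_bilipschitz[of X Y f B]) (auto simp: separated_net_def)
  qed
qed

end
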